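(* Let $\mathcal{G}$ be strongly connected, let each $f_i:\mathbb{R}^p\to\mathbb{R}$ ($i=1,\dots,n$) be convex with sub-gradients satisfying $\|\nabla f_i(\mathbf{x})\|\le D$ for all $\mathbf{x}\in\mathbb{R}^p$, and suppose that $f=\sum_{i=1}^n f_i$ attains its minimum $f^*$. Let $\{\mathbf{z}_i^k\}_{k\ge0}$, $1\le i\le 2n$, be generated by the D-DGD algorithm with parameter $\epsilon\in(0,\Upsilon)$ and step-sizes $\alpha_k=k^{-1/2}$ for $k\ge 1$ (with $\alpha_0\ge 0$ an arbitrary fixed number), and let $\overline{\mathbf{z}}^k=\frac1n\sum_{j=1}^{2n}\mathbf{z}_j^k$. Then $$\min_{0\le k\le K} f(\overline{\mathbf{z}}^k)-f^*=O\!\left(\frac{\ln K}{\sqrt{K}}\right)\qquad\text{as }K\to\infty.$$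
   Context: Network: $\mathcal{G}=(\mathcal{V},\mathcal{E})$ is a directed graph on $n$ agents $\mathcal{V}=\{1,\dots,n\}$; $(i,j)\in\mathcal{E}$ means agent $j$ can send information to agent $i$. $\mathcal{N}_i^{\mathrm{in}}$ is the set of agents that can send information to $i$, and $\mathcal{N}_i^{\mathrm{out}}$ is the set of agents that can receive information from $i$; both are allowed to include $i$ itself. Weights: $A=\{a_{ij}\}\in\mathbb{R}^{n\times n}$ has $a_{ij}>0$ if $j\in\mathcal{N}_i^{\mathrm{in}}$, $a_{ij}=0$ otherwise, and $\sum_{j=1}^n a_{ij}=1$ for all $i$ (row-stochastic). $B=\{b_{ij}\}\in\mathbb{R}^{n\times n}$ has $b_{ij}>0$ if $i\in\mathcal{N}_j^{\mathrm{out}}$, $b_{ij}=0$ otherwise, and $\sum_{i=1}^n b_{ij}=1$ for all $j$ (column-stochastic). For a scalar $\epsilon$, $$M=\begin{bmatrix}A & \epsilon I\\ I-A & B-\epsilon I\end{bmatrix}\in\mathbb{R}^{2n\times 2n}.$$ $\Upsilon=\frac{1}{(20+8n)^n}(1-|\lambda_3|)^n$, where $\lambda_3$ is the third largest eigenvalue in magnitude (with multiplicity) of the matrix $M$ obtained by setting $\epsilon=0$. Algorithm (D-DGD): from arbitrary initial vectors $\mathbf{x}_i^0,\mathbf{y}_i^0\in\mathbb{R}^p$, for $i=1,\dots,n$ and $k\ge 0$, $$\mathbf{x}_i^{k+1}=\sum_{j=1}^n a_{ij}\mathbf{x}_j^k+\epsilon\mathbf{y}_i^k-\alpha_k\nabla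 f_i(\mathbf{x}_i^k),\qquad \mathbf{y}_i^{k+1}=\mathbf{x}_i^k-\sum_{j=1}^n a_{ij}\mathbf{x}_j^k+\sum_{j=1}^n b_{ij}\mathbf{y}_j^k-\epsilon\mathbf{y}_i^k,$$ where $\nabla f_i(\mathbf{x})$ denotes a sub-gradient of $f_i$ at $\mathbf{x}$ ($f_i$ need not be differentiable). Set $\mathbf{z}_i^k=\mathbf{x}_i^k$ for $1\le i\le n$ and $\mathbf{z}_i^k=\mathbf{y}_{i-n}^k$ for $n+1\le i\le 2n$. $\|\cdot\|$ is the Euclidean norm. The constant implied by $O(\cdot)$ may depend on all problem data (network, weights, $\epsilon$, $D$, initial vectors, $\alpha_0$) but not on $K$. *)

theory Defs
  imports
    "HOL-Analysis.Convex"
    "HOL-Analysis.Euclidean_Space"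
    "HOL-Library.Landau_Symbols"
    "HOL-Computational_Algebra.Fundamental_Theorem_Algebra"
    "Jordan_Normal_Form.Char_Poly"
begin

text \<open>
  The agents are the numbers \<open>0, \<dots>, n - 1\<close>.  A network is its edge relation \<open>E\<close>, where
  \<open>(i, j) \<in> E\<close> means that agent \<open>j\<close> can send information to agent \<open>i\<close>; self-loops are
  allowed but not required.
\<close>

definition network :: "nat \<Rightarrow> (nat \<times> nat) set \<Rightarrow> bool" where
  "network n E \<longleftrightarrow> 0 < n \<and> E \<subseteq> {..<n} \<times> {..<n}"

definition strongly_connected :: "nat \<Rightarrow> (nat \<times> nat) set \<Rightarrow> bool" where
  "strongly_connected n E \<longleftrightarrow> (\<forall>i<n. \<forall>j<n. (i, j) \<in> E\<^sup>*)"

definition in_nbrs :: "(nat \<times> nat) set \<Rightarrow> nat \<Rightarrow> nat set" where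
  "in_nbrs E i = {j. (i, j) \<in> E}"

definition out_nbrs :: "(nat \<times> nat) set \<Rightarrow> nat \<Rightarrow> nat set" where
  "out_nbrs E j = {i. (i, j) \<in> E}"

definition row_weights :: "nat \<Rightarrow> (nat \<times> nat) set \<Rightarrow> real mat \<Rightarrow> bool" where
  "row_weights n E A \<longleftrightarrow>
     A \<in> carrier_mat n n \<and>
     (\<forall>i<n. \<forall>j<n. if j \<in> in_nbrs E i then A $$ (i, j) > 0 else A $$ (i, j) = 0) \<and>
     (\<forall>i<n. (\<Sum>j<n. A $$ (i, j)) = 1)"

definition col_weights :: "nat \<Rightarrow> (nat \<times> nat) set \<Rightarrow> real mat \<Rightarrow> bool" where
  "col_weights n E B \<longleftrightarrow>
     B \<in> carrier_mat n n \<and>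
     (\<forall>i<n. \<forall>j<n. if i \<in> out_nbrs E j then B $$ (i, j) > 0 else B $$ (i, j) = 0) \<and>
     (\<forall>j<n. (\<Sum>i<n. B $$ (i, j)) = 1)"

definition M_mat :: "nat \<Rightarrow> real mat \<Rightarrow> real mat \<Rightarrow> real \<Rightarrow> real mat" where
  "M_mat n A B \<epsilon> =
     four_block_mat A (\<epsilon> \<cdot>\<^sub>m 1\<^sub>m n) (1\<^sub>m n - A) (B - \<epsilon> \<cdot>\<^sub>m 1\<^sub>m n)"

text \<open>
  The moduli of all complex eigenvalues, listed with algebraic multiplicity in decreasing order.
\<close>

definition eigenvalue_moduli :: "real mat \<Rightarrow> real list" where
  "eigenvalue_moduli M =
     rev (sorted_list_of_multiset
       (image_mset cmod (proots (char_poly (map_mat complex_of_real M)))))"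

text \<open>
  Only the modulus of the third largest eigenvalue is determined, and only the modulus is used.
  For \<open>n = 1\<close> the matrix \<open>M\<close> has just two eigenvalues; the modulus is then taken to be \<open>0\<close>.
\<close>

definition abs_lambda3 :: "real mat \<Rightarrow> real" where
  "abs_lambda3 M =
     (if 3 \<le> length (eigenvalue_moduli M) then eigenvalue_moduli M ! 2 else 0)"

definition Upsilon :: "nat \<Rightarrow> real mat \<Rightarrow> real mat \<Rightarrow> real" where
  "Upsilon n A B = 1 / (20 + 8 * real n) ^ n * (1 - abs_lambda3 (M_mat n A B 0)) ^ n"

definition is_subgradient :: "('a::real_inner \<Rightarrow> real) \<Rightarrow> 'a \<Rightarrow> 'a \<Rightarrow> bool" where
  "is_subgradient f x v \<longleftrightarrow> (\<forall>y. f x + v \<bullet> (y - x) \<le> f y)"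

text \<open>
  \<open>g k i x\<close> is the sub-gradient of the \<open>i\<close>-th function at \<open>x\<close> that is used in iteration \<open>k\<close>.
  The choice among several sub-gradients may thus change from one iteration to the next; a fixed
  choice is the case where \<open>g\<close> does not depend on \<open>k\<close>.
\<close>

definition D_DGD ::
  "nat \<Rightarrow> real mat \<Rightarrow> real mat \<Rightarrow> real \<Rightarrow> (nat \<Rightarrow> real) \<Rightarrow> (nat \<Rightarrow> nat \<Rightarrow> 'a \<Rightarrow> 'a) \<Rightarrow>
   (nat \<Rightarrow> nat \<Rightarrow> 'a::real_vector) \<Rightarrow> (nat \<Rightarrow> nat \<Rightarrow> 'a) \<Rightarrow> bool" where
  "D_DGD n A B \<epsilon> \<alpha> g x y \<longleftrightarrow>
     (\<forall>k. \<forall>i<n.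
        x (Suc k) i =
          (\<Sum>j<n. (A $$ (i, j)) *\<^sub>R x k j) + \<epsilon> *\<^sub>R y k i - \<alpha> k *\<^sub>R g k i (x k i) \<and>
        y (Suc k) i =
          x k i - (\<Sum>j<n. (A $$ (i, j)) *\<^sub>R x k j)
            + (\<Sum>j<n. (B $$ (i, j)) *\<^sub>R y k j) - \<epsilon> *\<^sub>R y k i)"

definition stacked ::
  "nat \<Rightarrow> (nat \<Rightarrow> nat \<Rightarrow> 'a) \<Rightarrow> (nat \<Rightarrow> nat \<Rightarrow> 'a) \<Rightarrow> nat \<Rightarrow> nat \<Rightarrow> 'a" where
  "stacked n x y k i = (if i < n then x k i else y k (i - n))"

text \<open>The sum has \<open>2 n\<close> terms but is divided by \<open>n\<close>.\<close>

definition zbar ::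
  "nat \<Rightarrow> (nat \<Rightarrow> nat \<Rightarrow> 'a::real_vector) \<Rightarrow> (nat \<Rightarrow> nat \<Rightarrow> 'a) \<Rightarrow> nat \<Rightarrow> 'a" where
  "zbar n x y k = (1 / real n) *\<^sub>R (\<Sum>j<2 * n. stacked n x y k j)"

end

(* The mean zbar performs an inexact subgradient step, so the claim reduces to showing that
   the deviation of the stacked state from consensus is O(sum over r < k of gamma^(k-1-r) alpha_r)
   for some gamma < 1.  For that it suffices that M - (1/n) [1;0] 1^T has spectral radius < 1.
   An eigenvector (x, y) for an eigenvalue z with |z| >= 1 has total sum 0 and satisfies
   (z - A) x = eps y and (z - B) y = (1 - z) x.  Splitting off the Perron components of x and y
   leaves resolvents of A and B on invariant complements.  These are at most
   (3^(n-1) - 1) / (1 - |lambda_3|), in the sup norm for A and in the 1-norm for B, because A and B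
   are contractions there and all remaining eigenvalues have modulus at most |lambda_3|.
   For eps < Upsilon this forces x = y = 0. *)

theory Submission
  imports Defs "Jordan_Normal_Form.Spectral_Radius"
begin

section \<open>Resolvents of contractions\<close>

text \<open>Given a spectral gap \<open>\<delta> = 1 - |\<lambda>3| > 0\<close>, the eigenvalue 1 of
  \<open>M\<close> is double at \<open>\<epsilon> = 0\<close>. One copy persists for every
  \<open>\<epsilon>\<close>; the other has to move strictly inside the unit disc, heuristically to
  \<open>1 - \<epsilon> n p . v\<close> with the left Perron vector \<open>p\<close> of
  \<open>A\<close> and the right one \<open>v\<close> of \<open>B\<close>. The range of
  \<open>\<epsilon>\<close> is explicit, so continuity of eigenvalues does not help and every
  constant has to be tracked.

  The decisive constant is the resolvent bound \<open>R\<close>, of which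
  \<open>16 n \<epsilon> R (1 + R) < 1\<close> is required. Expanding the resolvent through the
  annihilating polynomial could cost \<open>\<delta>\<close> to the power \<open>-(n-1)\<close>,
  whose square is more than the factor \<open>\<delta>^n\<close> of \<open>Upsilon\<close> can pay
  for once \<open>n \<ge> 3\<close>. Blaschke factors keep \<open>R\<close> linear in
  \<open>1/\<delta>\<close>. Sup norm and 1-norm are not Hilbert norms, so such a factor of a
  contraction is bounded here by 3 instead of 1; this is the origin of
  \<open>3^(n-1)\<close>.\<close>

locale seminorm_contraction =
  fixes T :: "('i \<Rightarrow> complex) \<Rightarrow> 'i \<Rightarrow> complex" and N :: "('i \<Rightarrow> complex) \<Rightarrow> real"
  assumes T_lin: "T (\<lambda>i. a * u i + b * v i) = (\<lambda>i. a * T u i + b * T v i)"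
    and N_add: "N (\<lambda>i. u i + v i) \<le> N u + N v"
    and N_scale: "N (\<lambda>i. a * u i) = cmod a * N u"
    and T_contr: "N (T u) \<le> N u"
    and resolvent_surj: "cmod a < 1 \<Longrightarrow> \<exists>w. \<forall>i. w i - a * T w i = u i"
begin

abbreviation shift :: "complex \<Rightarrow> ('i \<Rightarrow> complex) \<Rightarrow> 'i \<Rightarrow> complex" where
  "shift a u \<equiv> (\<lambda>i. T u i - a * u i)"

lemma N_nonneg: "0 \<le> N u"
proof -
  have "N (\<lambda>i. u i + (- 1) * u i) \<le> N u + N (\<lambda>i. (- 1) * u i)"
    by (rule N_add)
  moreover have "N (\<lambda>i. (- 1) * u i) = N u" using N_scale[of "-1" u] by simp
  moreover have "N (\<lambda>i. u i + (- 1) * u i) = 0" using N_scale[of 0 u] by simp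
  ultimately show ?thesis by simp
qed

lemma N_lin: "N (\<lambda>i. a * u i + b * v i) \<le> cmod a * N u + cmod b * N v"
  using N_add[of "\<lambda>i. a * u i" "\<lambda>i. b * v i"] by (simp add: N_scale)

lemma T_combine:
  "T (\<lambda>i. a * u i - b * v i) i = a * T u i - b * T v i"
  "T (\<lambda>i. u i - b * v i) i = T u i - b * T v i"
  "T (\<lambda>i. a * u i - v i) i = a * T u i - T v i"
  using T_lin[of a u "-b" v] T_lin[of 1 u "-b" v] T_lin[of a u "-1" v] by (simp_all add: fun_eq_iff)

text \<open>Polynomials in \<open>T\<close> commute. For the factor \<open>1 - a T\<close> this
  allows an annihilated vector to be pulled back through a Blaschke denominator.\<close>

lemma foldr_shift_commute:
  "foldr shift \<mu>s (\<lambda>i. w i - a * T w i) =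
    (\<lambda>i. foldr shift \<mu>s w i - a * T (foldr shift \<mu>s w) i)"
proof (induction \<mu>s)
  case (Cons m \<mu>s)
  show ?case
    unfolding foldr_Cons comp_def Cons.IH by (simp add: T_combine algebra_simps)
qed simp

lemma N_le_resolvent:
  assumes "cmod a < 1"
  shows "(1 - cmod a) * N w \<le> N (\<lambda>i. w i - a * T w i)"
proof -
  have "N w = N (\<lambda>i. 1 * (w i - a * T w i) + a * T w i)" by (simp add: algebra_simps)
  also have "\<dots> \<le> cmod 1 * N (\<lambda>i. w i - a * T w i) + cmod a * N (T w)"
    by (rule N_lin)
  also have "\<dots> \<le> N (\<lambda>i. w i - a * T w i) + cmod a * N w"
    by (simp add: mult_left_mono T_contr)
  finally show ?thesis by (simp add: algebra_simps)
qed

text \<open>The identity is \<open>T - \<mu> = -\<mu> (1 - cnj \<mu> T) + (1 - |\<mu>|^2) T\<close>.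
  Bounding \<open>w\<close> by \<open>(1 - cnj \<mu> T) w\<close> costs
  \<open>1/(1 - |\<mu>|)\<close>, which the coefficient \<open>1 - |\<mu>|^2\<close> absorbs; what
  remains is \<open>1 + 2 |\<mu>|\<close>, uniform up to the unit circle.\<close>

lemma N_blaschke:
  assumes "cmod \<mu> < 1"
  shows "N (shift \<mu> w) \<le> 3 * N (\<lambda>i. w i - cnj \<mu> * T w i)"
proof -
  define v where "v = (\<lambda>i. w i - cnj \<mu> * T w i)"
  have sq: "\<mu> * cnj \<mu> = of_real ((cmod \<mu>)\<^sup>2)"
    by (rule complex_norm_square[symmetric])
  have "shift \<mu> w = (\<lambda>i. (- \<mu>) * v i + of_real (1 - (cmod \<mu>)\<^sup>2) * T w i)"
  proof
    fix i
    have "(- \<mu>) * v i + of_real (1 - (cmod \<mu>)\<^sup>2) * T w i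
      = - \<mu> * w i + (\<mu> * cnj \<mu>) * T w i + (1 - of_real ((cmod \<mu>)\<^sup>2)) * T w i"
      unfolding v_def by (simp add: algebra_simps)
    then show "shift \<mu> w i = (- \<mu>) * v i + of_real (1 - (cmod \<mu>)\<^sup>2) * T w i"
      unfolding sq by (simp add: algebra_simps)
  qed
  then have "N (shift \<mu> w) \<le> cmod (- \<mu>) * N v + cmod (of_real (1 - (cmod \<mu>)\<^sup>2)) * N (T w)"
    by (simp only: N_lin)
  also have "cmod (of_real (1 - (cmod \<mu>)\<^sup>2)) = 1 - (cmod \<mu>)\<^sup>2"
    using assms by (simp only: norm_of_real) (simp add: power_le_one)
  also have "\<dots> * N (T w) \<le> (1 - (cmod \<mu>)\<^sup>2) * N w"
    using assms by (intro mult_left_mono T_contr) (simp add: power_le_one)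
  also have "\<dots> = (1 + cmod \<mu>) * ((1 - cmod \<mu>) * N w)"
    by (simp add: power2_eq_square algebra_simps)
  also have "\<dots> \<le> (1 + cmod \<mu>) * N v"
    unfolding v_def using N_le_resolvent[of "cnj \<mu>" w] assms by (intro mult_left_mono) auto
  finally have "N (shift \<mu> w) \<le> (1 + 2 * cmod \<mu>) * N v" by (simp add: algebra_simps)
  also have "\<dots> \<le> 3 * N v" using assms by (intro mult_right_mono N_nonneg) auto
  finally show ?thesis unfolding v_def .
qed

lemma blaschke_denom_le:
  fixes z \<mu> :: complex
  assumes "1 \<le> cmod z" "cmod \<mu> < 1"
  shows "cmod (1 - cnj \<mu> * z) \<le> cmod (z - \<mu>)"
proof (rule power2_le_imp_le)
  have "(cmod (z - \<mu>))\<^sup>2 - (cmod (1 - cnj \<mu> * z))\<^sup>2 = ((cmod z)\<^sup>2 - 1) * (1 - (cmod \<mu>)\<^sup>2)"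
    unfolding cmod_power2 by (simp add: power2_eq_square algebra_simps)
  moreover have "0 \<le> ((cmod z)\<^sup>2 - 1) * (1 - (cmod \<mu>)\<^sup>2)"
    using assms by (intro mult_nonneg_nonneg) (simp_all add: power_le_one)
  ultimately show "(cmod (1 - cnj \<mu> * z))\<^sup>2 \<le> (cmod (z - \<mu>))\<^sup>2" by linarith
qed simp

text \<open>
  Writing \<open>x = (1 - cnj \<mu> T) w\<close>, the operator \<open>b = (T - \<mu>) (1 - cnj \<mu> T)\<^sup>-\<^sup>1\<close> is a Blaschke factor of
  norm at most \<open>3\<close>.  Since \<open>b(z) - b(T)\<close> is a bounded multiple of \<open>z - T\<close> and \<open>1 \<le> |b(z)|\<close>, each
  root \<open>\<mu>\<close> of the annihilating polynomial costs a constant factor only: the dependence on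
  the gap \<open>\<delta>\<close> stays linear.
\<close>

lemma resolvent_bound:
  assumes "1 \<le> cmod z" and "0 < \<delta>"
    and "\<And>\<mu>. \<mu> \<in> set \<mu>s \<Longrightarrow> cmod \<mu> \<le> 1 - \<delta>"
    and "N (foldr shift \<mu>s x) = 0"
  shows "N x \<le> (3 ^ length \<mu>s - 1) / \<delta> * N (\<lambda>i. z * x i - T x i)"
  using assms(3,4)
proof (induction \<mu>s arbitrary: x rule: rev_induct)
  case (snoc \<mu> \<mu>s)
  let ?m = "cmod \<mu>" and ?r = "\<lambda>u i. z * u i - T u i" and ?C = "(3 ^ length \<mu>s - 1) / \<delta>"
  have mu: "?m \<le> 1 - \<delta>" "?m < 1" using snoc.prems(1)[of \<mu>] assms(2) by auto
  obtain w where "\<forall>i. w i - cnj \<mu> * T w i = x i"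
    using resolvent_surj[of "cnj \<mu>" x] mu by auto
  then have x: "x = (\<lambda>i. w i - cnj \<mu> * T w i)" by auto
  define x' where "x' = shift \<mu> w"
  have C: "0 \<le> ?C" using assms(2) by simp
  have rx: "?r x = (\<lambda>i. ?r w i - cnj \<mu> * T (?r w) i)"
    unfolding x by (simp add: T_combine algebra_simps)
  \<comment> \<open>The last root is the innermost factor, so the other factors act on
    \<open>x'\<close>, which is \<open>b(T) x\<close>. The hypothesis says that
    \<open>1 - cnj \<mu> T\<close> maps their result to seminorm 0; as that factor is bounded below,
    the result itself has seminorm 0 and the induction hypothesis applies to
    \<open>x'\<close>.\<close>
  have "foldr shift (\<mu>s @ [\<mu>]) x =
      (\<lambda>i. foldr shift (\<mu>s @ [\<mu>]) w i - cnj \<mu> * T (foldr shift (\<mu>s @ [\<mu>]) w) i)"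
    unfolding x by (rule foldr_shift_commute)
  then have "(1 - ?m) * N (foldr shift \<mu>s x') \<le> 0"
    using N_le_resolvent[of "cnj \<mu>" "foldr shift \<mu>s x'"] snoc.prems(2) mu
    by (simp add: x'_def)
  then have "N (foldr shift \<mu>s x') = 0"
    using mu N_nonneg[of "foldr shift \<mu>s x'"] by (simp add: mult_le_0_iff)
  then have IH: "N x' \<le> ?C * N (?r x')"
    using snoc.IH[of x'] snoc.prems(1) by auto
  have "?r x' = shift \<mu> (?r w)"
    unfolding x'_def by (simp add: T_combine algebra_simps)
  then have rx': "N (?r x') \<le> 3 * N (?r x)"
    using N_blaschke[of \<mu> "?r w"] mu unfolding rx by simp
  have d: "\<delta> \<le> cmod (z - \<mu>)"
    using norm_triangle_ineq2[of z \<mu>] assms(1) mu by linarith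
  have sq: "\<mu> * cnj \<mu> = of_real ((cmod \<mu>)\<^sup>2)"
    by (rule complex_norm_square[symmetric])
  \<comment> \<open>The formula for \<open>b(z) - b(T)\<close> as a multiple of
    \<open>z - T\<close>, with \<open>w\<close> in place of the inverse operator. The scalar
    denominator \<open>1 - cnj \<mu> * z\<close> is cleared because it may vanish.\<close>
  have "(\<lambda>i. (z - \<mu>) * x i) = (\<lambda>i. (1 - cnj \<mu> * z) * x' i + of_real (1 - ?m\<^sup>2) * ?r w i)"
  proof
    fix i
    have "(1 - cnj \<mu> * z) * x' i + (1 - \<mu> * cnj \<mu>) * ?r w i = (z - \<mu>) * x i"
      unfolding x x'_def by (simp add: algebra_simps)
    then show "(z - \<mu>) * x i = (1 - cnj \<mu> * z) * x' i + of_real (1 - ?m\<^sup>2) * ?r w i"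
      unfolding sq by simp
  qed
  then have "N (\<lambda>i. (z - \<mu>) * x i) \<le> cmod (1 - cnj \<mu> * z) * N x' + cmod (of_real (1 - ?m\<^sup>2)) * N (?r w)"
    by (simp only: N_lin)
  then have "cmod (z - \<mu>) * N x \<le> cmod (1 - cnj \<mu> * z) * N x' + cmod (of_real (1 - ?m\<^sup>2)) * N (?r w)"
    by (simp only: N_scale)
  also have "cmod (of_real (1 - ?m\<^sup>2)) = 1 - ?m\<^sup>2"
    using mu by (simp only: norm_of_real) (simp add: power_le_one)
  also have "\<dots> * N (?r w) = (1 + ?m) * ((1 - ?m) * N (?r w))"
    by (simp add: power2_eq_square algebra_simps)
  also have "(1 + ?m) * ((1 - ?m) * N (?r w)) \<le> 2 * N (?r x)"
    unfolding rx using N_le_resolvent[of "cnj \<mu>" "?r w"] mu N_nonneg by (intro mult_mono) auto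
  also have "cmod (1 - cnj \<mu> * z) * N x' \<le> cmod (z - \<mu>) * N x'"
    by (intro mult_right_mono blaschke_denom_le N_nonneg) (use assms(1) mu in auto)
  also have "2 * N (?r x) = \<delta> * (2 / \<delta> * N (?r x))" using assms(2) by simp
  also have "\<dots> \<le> cmod (z - \<mu>) * (2 / \<delta> * N (?r x))"
    using d assms(2) N_nonneg by (intro mult_right_mono) auto
  finally have "cmod (z - \<mu>) * N x \<le> cmod (z - \<mu>) * (N x' + 2 / \<delta> * N (?r x))"
    by (simp add: algebra_simps)
  then have "N x \<le> N x' + 2 / \<delta> * N (?r x)"
    using d assms(2) by (subst (asm) mult_le_cancel_left_pos) auto
  \<comment> \<open>Passing from \<open>C\<close> to \<open>3 C + 2/\<delta>\<close>, starting at 0,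
    gives \<open>(3^k - 1)/\<delta>\<close> after \<open>k\<close> roots.\<close>
  also have "\<dots> \<le> ?C * (3 * N (?r x)) + 2 / \<delta> * N (?r x)"
    using IH mult_left_mono[OF rx' C] by linarith
  also have "\<dots> = (3 ^ length (\<mu>s @ [\<mu>]) - 1) / \<delta> * N (?r x)"
    using assms(2) by (simp add: field_simps)
  finally show ?case .
qed simp

end

section \<open>Irreducible stochastic matrices\<close>

text \<open>Positivity is asked along edges, so that one predicate serves the row weights, the
  column weights and, with reversed edges, the transposed row weights.\<close>

definition irreducible_nonneg :: "nat \<Rightarrow> (nat \<times> nat) set \<Rightarrow> (nat \<Rightarrow> nat \<Rightarrow> real) \<Rightarrow> bool" where
  "irreducible_nonneg n E b \<longleftrightarrow> 0 < n \<and> E \<subseteq> {..<n} \<times> {..<n} \<and> strongly_connected n E \<and>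
     (\<forall>i<n. \<forall>j<n. 0 \<le> b i j) \<and> (\<forall>(i, j)\<in>E. 0 < b i j)"

text \<open>A fixed point satisfies \<open>b i j * w j \<le> w i\<close>, so positivity passes from
  \<open>j\<close> to \<open>i\<close> for every edge \<open>(i, j)\<close>. The facts below apply
  this to \<open>|u| - u\<close>, to \<open>u - m\<close> with the minimum \<open>m\<close>, and to
  \<open>|w|\<close>.\<close>

lemma nonneg_fixed_point_pos:
  assumes "irreducible_nonneg n E b"
    and fixed: "\<And>i. i < n \<Longrightarrow> (\<Sum>j<n. b i j * w j) = w i"
    and nonneg: "\<And>i. i < n \<Longrightarrow> 0 \<le> w i" and "k < n" "w k \<noteq> 0" and "i < n"
  shows "0 < w i"
proof -
  have "(i, k) \<in> E\<^sup>*"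
    using assms by (simp add: irreducible_nonneg_def strongly_connected_def)
  then show ?thesis using \<open>i < n\<close>
  proof (induction rule: converse_rtrancl_induct)
    case base
    then show ?case using nonneg[OF \<open>k < n\<close>] \<open>w k \<noteq> 0\<close> by simp
  next
    case (step i j)
    then have *: "i < n" "j < n" "0 < b i j" "\<And>l. l < n \<Longrightarrow> 0 \<le> b i l"
      using assms(1) by (auto simp: irreducible_nonneg_def)
    have "0 < b i j * w j" using step * by simp
    also have "\<dots> \<le> (\<Sum>l<n. b i l * w l)"
      using * nonneg by (intro member_le_sum) auto
    finally show ?case using fixed * by simp
  qed
qed

text \<open>The triangle inequality gives \<open>|u| \<le> b |u|\<close> entrywise. Column sums 1
  give both sides the same total, so equality holds in every entry.\<close>

lemma column_stochastic_fixed_cmod: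
  fixes u :: "nat \<Rightarrow> complex"
  assumes nonneg: "\<And>i j. i < n \<Longrightarrow> j < n \<Longrightarrow> 0 \<le> b i j"
    and col: "\<And>j. j < n \<Longrightarrow> (\<Sum>i<n. b i j) = (1::real)"
    and fixed: "\<And>i. i < n \<Longrightarrow> (\<Sum>j<n. of_real (b i j) * u j) = u i" and "i < n"
  shows "(\<Sum>j<n. b i j * cmod (u j)) = cmod (u i)"
proof -
  have le: "cmod (u i) \<le> (\<Sum>j<n. b i j * cmod (u j))" if "i < n" for i
  proof -
    have "cmod (u i) \<le> (\<Sum>j<n. cmod (of_real (b i j) * u j))"
      using fixed[OF that] norm_sum by metis
    also have "\<dots> = (\<Sum>j<n. b i j * cmod (u j))"
      using nonneg that by (intro sum.cong) (auto simp: norm_mult)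
    finally show ?thesis .
  qed
  have "(\<Sum>i<n. \<Sum>j<n. b i j * cmod (u j)) = (\<Sum>j<n. \<Sum>i<n. b i j * cmod (u j))"
    by (rule sum.swap)
  also have "\<dots> = (\<Sum>j<n. cmod (u j))"
    using col by (intro sum.cong) (auto simp flip: sum_distrib_right)
  finally have "(\<Sum>i<n. (\<Sum>j<n. b i j * cmod (u j)) - cmod (u i)) = 0"
    by (simp add: sum_subtractf)
  then have "\<forall>i\<in>{..<n}. (\<Sum>j<n. b i j * cmod (u j)) - cmod (u i) = 0"
    using le by (subst (asm) sum_nonneg_eq_0_iff) auto
  then show ?thesis using \<open>i < n\<close> by simp
qed

lemma fixed_Re_Im:
  assumes "\<And>i. i < n \<Longrightarrow> (\<Sum>j<n. complex_of_real (b i j) * u j) = u i" and "i < n"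
  shows "(\<Sum>j<n. b i j * Re (u j)) = Re (u i)" "(\<Sum>j<n. b i j * Im (u j)) = Im (u i)"
  using arg_cong[OF assms(1)[OF assms(2)], of Re] arg_cong[OF assms(1)[OF assms(2)], of Im]
  by simp_all

text \<open>The nonnegative fixed point \<open>|u| - u\<close> is either 0 or positive everywhere.
  In the second case all \<open>u i\<close> are negative, in the first all are nonnegative; total 0
  leaves only \<open>u = 0\<close>.\<close>

lemma column_stochastic_fixed_sum_zero_real:
  fixes u :: "nat \<Rightarrow> real"
  assumes irr: "irreducible_nonneg n E b"
    and col: "\<And>j. j < n \<Longrightarrow> (\<Sum>i<n. b i j) = 1"
    and fixed: "\<And>i. i < n \<Longrightarrow> (\<Sum>j<n. b i j * u j) = u i"
    and sum0: "(\<Sum>i<n. u i) = 0" and "i < n"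
  shows "u i = 0"
proof -
  have nonneg: "\<And>i j. i < n \<Longrightarrow> j < n \<Longrightarrow> 0 \<le> b i j" and "0 < n"
    using irr by (auto simp: irreducible_nonneg_def)
  have abs: "(\<Sum>j<n. b i j * \<bar>u j\<bar>) = \<bar>u i\<bar>" if "i < n" for i
    using column_stochastic_fixed_cmod[of n b "\<lambda>j. of_real (u j)" i] nonneg col fixed that
    by (simp flip: of_real_mult of_real_sum)
  have fix2: "(\<Sum>j<n. b i j * (\<bar>u j\<bar> - u j)) = \<bar>u i\<bar> - u i" if "i < n" for i
    using abs[OF that] fixed[OF that] by (simp add: right_diff_distrib sum_subtractf)
  have u0: "\<bar>u k\<bar> - u k = 0" if "k < n" for k
  proof (rule ccontr)
    assume "\<bar>u k\<bar> - u k \<noteq> 0"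
    then have "0 < \<bar>u i\<bar> - u i" if "i < n" for i
      using nonneg_fixed_point_pos[OF irr fix2 _ \<open>k < n\<close> _ that] by simp
    then have "0 < (\<Sum>i<n. - u i)"
      using \<open>0 < n\<close> by (intro sum_pos) (auto, force)
    then show False using sum0 by (simp add: sum_negf)
  qed
  have "\<forall>k\<in>{..<n}. 0 \<le> u k"
  proof
    fix k assume "k \<in> {..<n}"
    then show "0 \<le> u k" using u0[of k] abs_ge_zero[of "u k"] by simp
  qed
  then show ?thesis using sum0 \<open>i < n\<close> by (subst (asm) sum_nonneg_eq_0_iff) auto
qed

lemma column_stochastic_fixed_sum_zero:
  fixes u :: "nat \<Rightarrow> complex"
  assumes irr: "irreducible_nonneg n E b"
    and col: "\<And>j. j < n \<Longrightarrow> (\<Sum>i<n. b i j) = 1"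
    and fixed: "\<And>i. i < n \<Longrightarrow> (\<Sum>j<n. of_real (b i j) * u j) = u i"
    and sum0: "(\<Sum>i<n. u i) = 0" and "i < n"
  shows "u i = 0"
proof (rule complex_eqI)
  have "(\<Sum>i<n. Re (u i)) = 0" "(\<Sum>i<n. Im (u i)) = 0"
    using arg_cong[OF sum0, of Re] arg_cong[OF sum0, of Im] by simp_all
  then show "Re (u i) = Re 0" "Im (u i) = Im 0"
    using column_stochastic_fixed_sum_zero_real[OF irr col, of "\<lambda>j. Re (u j)" i]
      column_stochastic_fixed_sum_zero_real[OF irr col, of "\<lambda>j. Im (u j)" i]
      fixed_Re_Im[OF fixed] \<open>i < n\<close> by simp_all
qed

text \<open>Minimum principle: \<open>u - m\<close> is a nonnegative fixed point with a zero entry,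
  hence 0. So \<open>u\<close> is constant, and its \<open>p\<close>-average is that
  constant.\<close>

lemma row_stochastic_fixed_real:
  fixes u :: "nat \<Rightarrow> real"
  assumes irr: "irreducible_nonneg n E a"
    and row: "\<And>i. i < n \<Longrightarrow> (\<Sum>j<n. a i j) = 1"
    and fixed: "\<And>i. i < n \<Longrightarrow> (\<Sum>j<n. a i j * u j) = u i"
    and p1: "(\<Sum>i<n. p i) = 1" and p0: "(\<Sum>i<n. p i * u i) = 0" and "i < n"
  shows "u i = 0"
proof -
  have "0 < n" using \<open>i < n\<close> by simp
  define m where "m = Min (u ` {..<n})"
  have "m \<in> u ` {..<n}" unfolding m_def using \<open>0 < n\<close> by (intro Min_in) auto
  then obtain k where k: "k < n" "u k = m" by auto
  have ge: "m \<le> u i" if "i < n" for i unfolding m_def using that by simp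
  have fix2: "(\<Sum>j<n. a i j * (u j - m)) = u i - m" if "i < n" for i
    using fixed[OF that] row[OF that]
    by (simp add: right_diff_distrib sum_subtractf flip: sum_distrib_right)
  have const: "u i = m" if "i < n" for i
  proof (rule ccontr)
    assume "u i \<noteq> m"
    then have "0 < u k - m"
      using nonneg_fixed_point_pos[OF irr fix2 _ \<open>i < n\<close> _ \<open>k < n\<close>] ge by simp
    then show False using k by simp
  qed
  have "(\<Sum>i<n. p i * u i) = m"
    using const p1 by (simp flip: sum_distrib_right)
  then show ?thesis using p0 const \<open>i < n\<close> by simp
qed

lemma row_stochastic_fixed:
  fixes u :: "nat \<Rightarrow> complex"
  assumes irr: "irreducible_nonneg n E a"
    and row: "\<And>i. i < n \<Longrightarrow> (\<Sum>j<n. a i j) = 1"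
    and fixed: "\<And>i. i < n \<Longrightarrow> (\<Sum>j<n. of_real (a i j) * u j) = u i"
    and p1: "(\<Sum>i<n. p i) = 1" and p0: "(\<Sum>i<n. of_real (p i) * u i) = 0" and "i < n"
  shows "u i = 0"
proof (rule complex_eqI)
  have "(\<Sum>i<n. p i * Re (u i)) = 0" "(\<Sum>i<n. p i * Im (u i)) = 0"
    using arg_cong[OF p0, of Re] arg_cong[OF p0, of Im] by simp_all
  then show "Re (u i) = Re 0" "Im (u i) = Im 0"
    using row_stochastic_fixed_real[OF irr row _ p1, of "\<lambda>j. Re (u j)" i]
      row_stochastic_fixed_real[OF irr row _ p1, of "\<lambda>j. Im (u j)" i]
      fixed_Re_Im[OF fixed] \<open>i < n\<close> by simp_all
qed

lemma column_stochastic_eigenvalue_1: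
  fixes B :: "'a::field mat"
  assumes B: "B \<in> carrier_mat n n" and "0 < n"
    and col: "\<And>j. j < n \<Longrightarrow> (\<Sum>i<n. B $$ (i, j)) = 1"
  shows "eigenvalue B 1"
proof -
  have Bt: "transpose_mat B \<in> carrier_mat n n" using B by simp
  have "eigenvector (transpose_mat B) (vec n (\<lambda>_. 1::'a)) 1"
    unfolding eigenvector_def
  proof (intro conjI)
    show "vec n (\<lambda>_. 1::'a) \<noteq> 0\<^sub>v (dim_row B\<^sup>T)"
      using B \<open>0 < n\<close> by (auto dest!: arg_cong[of _ _ "\<lambda>v. v $ 0"])
    show "B\<^sup>T *\<^sub>v vec n (\<lambda>_. 1::'a) = 1 \<cdot>\<^sub>v vec n (\<lambda>_. 1::'a)"
      using B col by (intro eq_vecI) (auto simp: scalar_prod_def lessThan_atLeast0)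
  qed (use B in auto)
  then have "eigenvalue (transpose_mat B) 1" unfolding eigenvalue_def by blast
  then show ?thesis
    using eigenvalue_root_char_poly[OF Bt] eigenvalue_root_char_poly[OF B] char_poly_transpose_mat[OF B]
    by simp
qed

text \<open>The transpose fixes the all-ones vector, so 1 is an eigenvalue. The entrywise modulus of
  an eigenvector is again fixed, and irreducibility makes it positive.\<close>

lemma perron_vector_exists:
  assumes irr: "irreducible_nonneg n E b"
    and col: "\<And>j. j < n \<Longrightarrow> (\<Sum>i<n. b i j) = 1"
  shows "\<exists>v. (\<forall>i<n. 0 < v i) \<and> (\<Sum>i<n. v i) = 1 \<and> (\<forall>i<n. (\<Sum>j<n. b i j * v j) = v i)"
proof -
  have nonneg: "\<And>i j. i < n \<Longrightarrow> j < n \<Longrightarrow> 0 \<le> b i j" and "0 < n"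
    using irr by (auto simp: irreducible_nonneg_def)
  define B where "B = mat n n (\<lambda>(i, j). b i j)"
  have B: "B \<in> carrier_mat n n" unfolding B_def by simp
  have "eigenvalue B 1"
    using column_stochastic_eigenvalue_1[OF B \<open>0 < n\<close>] col by (simp add: B_def)
  then obtain w where "eigenvector B w 1" unfolding eigenvalue_def by blast
  then have w: "w \<in> carrier_vec n" "w \<noteq> 0\<^sub>v n" "B *\<^sub>v w = w"
    using B unfolding eigenvector_def by auto
  have fixed: "(\<Sum>j<n. b i j * w $ j) = w $ i" if "i < n" for i
    using arg_cong[OF w(3), of "\<lambda>v. v $ i"] that w(1) B
    by (simp add: B_def scalar_prod_def lessThan_atLeast0)
  have abs: "(\<Sum>j<n. b i j * \<bar>w $ j\<bar>) = \<bar>w $ i\<bar>" if "i < n" for i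
    using column_stochastic_fixed_cmod[of n b "\<lambda>j. of_real (w $ j)" i] nonneg col fixed that
    by (simp flip: of_real_mult of_real_sum)
  obtain k where k: "k < n" "w $ k \<noteq> 0"
    using w(1,2) by (metis carrier_vecD eq_vecI index_zero_vec)
  then have pos: "0 < \<bar>w $ i\<bar>" if "i < n" for i
    using nonneg_fixed_point_pos[OF irr abs _ k(1) _ that] by simp
  define s where "s = (\<Sum>i<n. \<bar>w $ i\<bar>)"
  have "0 < s" unfolding s_def using pos \<open>0 < n\<close> by (intro sum_pos) auto
  show ?thesis
  proof (intro exI[of _ "\<lambda>i. \<bar>w $ i\<bar> / s"] conjI allI impI)
    show "(\<Sum>i<n. \<bar>w $ i\<bar> / s) = 1"
      using \<open>0 < s\<close> by (simp add: s_def flip: sum_divide_distrib)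
    show "(\<Sum>j<n. b i j * (\<bar>w $ j\<bar> / s)) = \<bar>w $ i\<bar> / s" if "i < n" for i
      using abs[OF that] by (simp flip: sum_divide_distrib)
  qed (use pos \<open>0 < s\<close> in auto)
qed

section \<open>Resolvent bounds off the Perron vector\<close>

text \<open>The factor for the diagonal entry at index \<open>k\<close> maps vectors supported on
  indices up to \<open>k\<close> to vectors supported below \<open>k\<close>. The innermost factor
  therefore belongs to the last index of the support, which is the order in which
  \<open>foldr\<close> applies the list.\<close>

lemma upper_triangular_annihilates:
  fixes U :: "'a::comm_ring_1 mat"
  assumes U: "U \<in> carrier_mat n n" "upper_triangular U"
    and "k \<le> n" "v \<in> carrier_vec n" "\<And>i. k \<le> i \<Longrightarrow> i < n \<Longrightarrow> v $ i = 0"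
  shows "foldr (\<lambda>e v. U *\<^sub>v v - e \<cdot>\<^sub>v v) (take k (diag_mat U)) v = 0\<^sub>v n"
  using assms(3-5)
proof (induction k arbitrary: v)
  case 0
  then show ?case by (intro eq_vecI) auto
next
  case (Suc k)
  define e where "e = U $$ (k, k)"
  have len: "length (diag_mat U) = n" using U by (simp add: diag_mat_def)
  have "take (Suc k) (diag_mat U) = take k (diag_mat U) @ [e]"
    using Suc.prems(1) U len by (simp add: take_Suc_conv_app_nth e_def diag_mat_def)
  moreover have "foldr (\<lambda>e v. U *\<^sub>v v - e \<cdot>\<^sub>v v) (take k (diag_mat U)) (U *\<^sub>v v - e \<cdot>\<^sub>v v) = 0\<^sub>v n"
  proof (rule Suc.IH)
    fix i assume i: "k \<le> i" "i < n"
    have "(U *\<^sub>v v) $ i = (\<Sum>j<n. U $$ (i, j) * v $ j)"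
      using U Suc.prems(2) i by (simp add: scalar_prod_def lessThan_atLeast0)
    also have "\<dots> = (\<Sum>j<n. if j = i then U $$ (i, i) * v $ i else 0)"
    proof (intro sum.cong refl)
      fix j assume "j \<in> {..<n}"
      then show "U $$ (i, j) * v $ j = (if j = i then U $$ (i, i) * v $ i else 0)"
        using upper_triangularD[OF U(2), of j i] U(1) i Suc.prems(3)[of j] by (cases j i rule: linorder_cases) auto
    qed
    also have "\<dots> = U $$ (i, i) * v $ i" using i by simp
    also have "\<dots> = e * v $ i"
      using Suc.prems(3)[of i] i by (cases "i = k") (auto simp: e_def)
    finally show "(U *\<^sub>v v - e \<cdot>\<^sub>v v) $ i = 0"
      using U Suc.prems(2) i by simp
  qed (use Suc.prems U in auto)
  ultimately show ?case by simp
qed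

text \<open>Cayley-Hamilton in factored form, reduced to the triangular case by Schur decomposition.
  The product appears as iterated application to a vector, the shape in which the resolvent bound
  takes it.\<close>

lemma char_poly_roots_annihilate:
  fixes A :: "'a::conjugatable_ordered_field mat"
  assumes A: "A \<in> carrier_mat n n" and cp: "char_poly A = (\<Prod>e\<leftarrow>es. [:- e, 1:])"
    and v: "v \<in> carrier_vec n"
  shows "foldr (\<lambda>e v. A *\<^sub>v v - e \<cdot>\<^sub>v v) es v = 0\<^sub>v n"
proof -
  obtain U P Q where "schur_decomposition A es = (U, P, Q)"
    by (cases "schur_decomposition A es") auto
  from schur_decomposition[OF A cp this]
  have sim: "similar_mat_wit A U P Q" and U: "upper_triangular U" "diag_mat U = es" by auto
  from similar_mat_witD2[OF A sim] have
    carr: "U \<in> carrier_mat n n" "P \<in> carrier_mat n n" "Q \<in> carrier_mat n n"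
    and PQ: "P * Q = 1\<^sub>m n" "Q * P = 1\<^sub>m n" and AU: "A = P * U * Q" by auto
  have "A * P = P * U * (Q * P)" unfolding AU using carr by (simp add: assoc_mult_mat[of _ n n _ n _ n])
  then have AP: "A * P = P * U" unfolding PQ using carr by simp
  have transport: "foldr (\<lambda>e v. A *\<^sub>v v - e \<cdot>\<^sub>v v) fs (P *\<^sub>v w) = P *\<^sub>v foldr (\<lambda>e v. U *\<^sub>v v - e \<cdot>\<^sub>v v) fs w
      \<and> foldr (\<lambda>e v. U *\<^sub>v v - e \<cdot>\<^sub>v v) fs w \<in> carrier_vec n"
    if "w \<in> carrier_vec n" for fs w
  proof (induction fs)
    case (Cons e fs)
    let ?w = "foldr (\<lambda>e v. U *\<^sub>v v - e \<cdot>\<^sub>v v) fs w"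
    have w: "?w \<in> carrier_vec n" using Cons by simp
    have "A *\<^sub>v (P *\<^sub>v ?w) = (A * P) *\<^sub>v ?w"
      using A carr w by (simp add: assoc_mult_mat_vec[of _ n n _ n])
    also have "\<dots> = P *\<^sub>v (U *\<^sub>v ?w)"
      unfolding AP using carr w by (simp add: assoc_mult_mat_vec[of _ n n _ n])
    finally have "A *\<^sub>v (P *\<^sub>v ?w) = P *\<^sub>v (U *\<^sub>v ?w)" .
    then show ?case
      using Cons carr w by (simp add: mult_minus_distrib_mat_vec[of _ n n] mult_mat_vec[of _ n n])
  qed (use that in simp)
  have "foldr (\<lambda>e v. U *\<^sub>v v - e \<cdot>\<^sub>v v) (take n (diag_mat U)) (Q *\<^sub>v v) = 0\<^sub>v n"
    by (rule upper_triangular_annihilates) (use carr U v in auto)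
  moreover have "length (diag_mat U) = n" using carr by (simp add: diag_mat_def)
  then have "take n (diag_mat U) = es" using U(2) by simp
  moreover have "P *\<^sub>v (Q *\<^sub>v v) = v"
    using assoc_mult_mat_vec[OF carr(2,3) v] v PQ(1) by simp
  ultimately show ?thesis
    using transport[of "Q *\<^sub>v v" es] carr v by (auto intro!: eq_vecI)
qed

section \<open>Real matrices acting on complex sequences\<close>

definition act :: "nat \<Rightarrow> (nat \<Rightarrow> nat \<Rightarrow> real) \<Rightarrow> (nat \<Rightarrow> complex) \<Rightarrow> nat \<Rightarrow> complex" where
  "act n a u i = (\<Sum>j<n. of_real (a i j) * u j)"

definition cmat :: "nat \<Rightarrow> (nat \<Rightarrow> nat \<Rightarrow> real) \<Rightarrow> complex mat" where
  "cmat n a = mat n n (\<lambda>(i, j). of_real (a i j))"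

lemma cmat_carrier [simp]: "cmat n a \<in> carrier_mat n n"
  by (simp add: cmat_def)

lemma cmat_mult_vec: "v \<in> carrier_vec n \<Longrightarrow> i < n \<Longrightarrow> (cmat n a *\<^sub>v v) $ i = act n a (($) v) i"
  by (simp add: cmat_def act_def scalar_prod_def lessThan_atLeast0)

lemma act_lin: "act n a (\<lambda>i. c * u i + d * v i) = (\<lambda>i. c * act n a u i + d * act n a v i)"
  by (simp add: fun_eq_iff act_def sum.distrib sum_distrib_left algebra_simps)

lemma act_cong: "(\<And>j. j < n \<Longrightarrow> u j = v j) \<Longrightarrow> act n a u i = act n a v i"
  by (simp add: act_def)

lemma sum_act_left:
  assumes "\<And>j. j < n \<Longrightarrow> (\<Sum>i<n. p i * a i j) = p j"
  shows "(\<Sum>i<n. of_real (p i) * act n a u i) = (\<Sum>j<n. of_real (p j) * u j)"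
proof -
  have "(\<Sum>i<n. of_real (p i) * act n a u i) = (\<Sum>i<n. \<Sum>j<n. of_real (p i * a i j) * u j)"
    by (simp add: act_def sum_distrib_left mult.assoc)
  also have "\<dots> = (\<Sum>j<n. \<Sum>i<n. of_real (p i * a i j) * u j)" by (rule sum.swap)
  also have "\<dots> = (\<Sum>j<n. of_real (\<Sum>i<n. p i * a i j) * u j)"
    by (simp add: sum_distrib_right)
  finally show ?thesis using assms by simp
qed

lemma vec_foldr_act:
  "vec n (foldr (\<lambda>m u i. act n a u i - m * u i) es u) =
    foldr (\<lambda>e v. cmat n a *\<^sub>v v - e \<cdot>\<^sub>v v) es (vec n u)"
proof (induction es)
  case (Cons e es)
  let ?u = "foldr (\<lambda>m u i. act n a u i - m * u i) es u"
  have "vec n (\<lambda>i. act n a ?u i - e * ?u i) = cmat n a *\<^sub>v vec n ?u - e \<cdot>\<^sub>v vec n ?u"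
  proof (rule eq_vecI)
    fix i assume "i < dim_vec (cmat n a *\<^sub>v vec n ?u - e \<cdot>\<^sub>v vec n ?u)"
    then have i: "i < n" by (simp add: cmat_def)
    show "vec n (\<lambda>i. act n a ?u i - e * ?u i) $ i = (cmat n a *\<^sub>v vec n ?u - e \<cdot>\<^sub>v vec n ?u) $ i"
    proof -
      have "(cmat n a *\<^sub>v vec n ?u) $ i = act n a (($) (vec n ?u)) i"
        by (rule cmat_mult_vec) (use i in auto)
      also have "\<dots> = act n a ?u i" by (rule act_cong) simp
      finally have *: "(cmat n a *\<^sub>v vec n ?u) $ i = act n a ?u i" .
      have "dim_vec (cmat n a *\<^sub>v vec n ?u) = n" by (simp add: cmat_def)
      then show ?thesis using i * by simp
    qed
  qed (simp add: cmat_def)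
  then show ?case using Cons by simp
qed simp

lemma resolvent_equation_solvable:
  assumes inj: "\<And>u. (\<And>i. i < n \<Longrightarrow> u i = c * act n a u i) \<Longrightarrow> \<forall>i<n. u i = 0"
  shows "\<exists>w. \<forall>i. w i - c * act n a w i = x i"
proof -
  define R where "R = mat n n (\<lambda>(i, j). (if i = j then 1 else 0) - c * of_real (a i j))"
  have R: "R \<in> carrier_mat n n" unfolding R_def by simp
  have Rv: "(R *\<^sub>v v) $ i = v $ i - c * act n a (($) v) i" if "v \<in> carrier_vec n" "i < n" for v i
  proof -
    have "(R *\<^sub>v v) $ i = (\<Sum>j<n. ((if i = j then 1 else 0) - c * of_real (a i j)) * v $ j)"
      using that by (simp add: R_def scalar_prod_def lessThan_atLeast0)
    also have "\<dots> = (\<Sum>j<n. (if i = j then v $ i else 0) - c * (of_real (a i j) * v $ j))"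
      by (intro sum.cong) (auto simp: algebra_simps)
    also have "\<dots> = v $ i - c * act n a (($) v) i"
      using that by (simp add: sum_subtractf act_def sum_distrib_left)
    finally show ?thesis .
  qed
  have "det R \<noteq> 0"
  proof
    assume "det R = 0"
    then obtain v where v: "v \<in> carrier_vec n" "v \<noteq> 0\<^sub>v n" "R *\<^sub>v v = 0\<^sub>v n"
      using det_0_iff_vec_prod_zero[OF R] by auto
    have "\<forall>i<n. v $ i = 0"
    proof (rule inj)
      fix i assume "i < n"
      then show "v $ i = c * act n a (($) v) i" using Rv[OF v(1)] v(3) by simp
    qed
    then show False using v(1,2) by (auto intro: eq_vecI)
  qed
  then obtain S where S: "S \<in> carrier_mat n n" "R * S = 1\<^sub>m n"
    using det_non_zero_imp_unit[OF R, of "()"] by (auto simp: Units_def ring_mat_def)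
  define w0 where "w0 = S *\<^sub>v vec n x"
  have w0: "w0 \<in> carrier_vec n" and Rw0: "R *\<^sub>v w0 = vec n x"
    using R S by (simp_all add: w0_def flip: assoc_mult_mat_vec[of _ n n _ n])
  \<comment> \<open>\<open>act\<close> reads only the coordinates below \<open>n\<close>. The finite
    system determines those; the equation, which is demanded for all \<open>i\<close>, then gives
    the others explicitly.\<close>
  define w where "w i = (if i < n then w0 $ i else x i + c * act n a (($) w0) i)" for i
  have "act n a w i = act n a (($) w0) i" for i by (rule act_cong) (simp add: w_def)
  moreover have "x i = w0 $ i - c * act n a (($) w0) i" if "i < n" for i
    using Rv[OF w0 that] Rw0 that by simp
  ultimately have "\<forall>i. w i - c * act n a w i = x i" by (simp add: w_def)
  then show ?thesis by blast
qed

text \<open>Vectors are functions on all natural numbers, and \<open>N\<close> is a norm on their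
  first \<open>n\<close> entries, hence a mere seminorm on the functions. Contractivity makes
  \<open>1 - c T\<close> injective for \<open>|c| < 1\<close>; finite dimension turns this into the
  solvability that \<open>seminorm_contraction\<close> asks for, in place of a Neumann
  series.\<close>

locale matrix_contraction =
  fixes n :: nat and a :: "nat \<Rightarrow> nat \<Rightarrow> real" and N :: "(nat \<Rightarrow> complex) \<Rightarrow> real"
  assumes N_add: "N (\<lambda>i. u i + v i) \<le> N u + N v"
    and N_scale: "N (\<lambda>i. c * u i) = cmod c * N u"
    and N_zero: "N u = 0 \<longleftrightarrow> (\<forall>i<n. u i = 0)"
    and act_contr: "N (act n a u) \<le> N u"
begin

sublocale seminorm_contraction "act n a" N
proof
  fix c :: complex and x assume c: "cmod c < 1"
  show "\<exists>w. \<forall>i. w i - c * act n a w i = x i"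
  proof (rule resolvent_equation_solvable)
    fix u assume u: "\<And>i. i < n \<Longrightarrow> u i = c * act n a u i"
    have "N u = N (\<lambda>i. (u i - c * act n a u i) + c * act n a u i)" by simp
    also have "\<dots> \<le> N (\<lambda>i. u i - c * act n a u i) + N (\<lambda>i. c * act n a u i)" by (rule N_add)
    also have "N (\<lambda>i. u i - c * act n a u i) = 0" using u unfolding N_zero by simp
    also have "N (\<lambda>i. c * act n a u i) \<le> cmod c * N u"
      unfolding N_scale by (intro mult_left_mono act_contr) simp
    finally have "(1 - cmod c) * N u \<le> 0" by (simp add: algebra_simps)
    moreover have "0 \<le> N u"
      using N_add[of u "\<lambda>i. - 1 * u i"] N_scale[of "-1" u] N_zero[of "\<lambda>i. u i + - 1 * u i"] by simp
    ultimately have "N u = 0" using c by (simp add: mult_le_0_iff)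
    then show "\<forall>i<n. u i = 0" unfolding N_zero .
  qed
qed (use N_add N_scale act_contr act_lin in auto)

lemma eigenvalue_le_1:
  assumes "eigenvalue (cmat n a) z"
  shows "cmod z \<le> 1"
proof -
  obtain v where "eigenvector (cmat n a) v z" using assms unfolding eigenvalue_def by blast
  then have v: "v \<in> carrier_vec n" "v \<noteq> 0\<^sub>v n" "cmat n a *\<^sub>v v = z \<cdot>\<^sub>v v"
    by (auto simp: eigenvector_def cmat_def)
  have act: "act n a (($) v) i = z * v $ i" if "i < n" for i
    using cmat_mult_vec[OF v(1) that, of a] v(1,3) that by simp
  have "N (\<lambda>i. z * v $ i) = N (\<lambda>i. act n a (($) v) i + (z * v $ i - act n a (($) v) i))" by simp
  also have "\<dots> \<le> N (act n a (($) v)) + N (\<lambda>i. z * v $ i - act n a (($) v) i)" by (rule N_add)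
  also have "N (\<lambda>i. z * v $ i - act n a (($) v) i) = 0" unfolding N_zero using act by simp
  finally have "cmod z * N (($) v) \<le> 1 * N (($) v)"
    using act_contr[of "($) v"] by (simp add: N_scale)
  moreover have "N (($) v) \<noteq> 0" unfolding N_zero using v(1,2) by (auto intro: eq_vecI)
  ultimately show ?thesis using N_nonneg[of "($) v"] by (subst (asm) mult_le_cancel_right) auto
qed

lemma complement_resolvent_bound:
  assumes cp: "char_poly (cmat n a) = (\<Prod>e\<leftarrow>1 # \<mu>s. [:- e, 1:])"
    and z: "1 \<le> cmod z" and "0 < \<delta>" and gap: "\<And>\<mu>. \<mu> \<in> set \<mu>s \<Longrightarrow> cmod \<mu> \<le> 1 - \<delta>"
    and left: "\<And>j. j < n \<Longrightarrow> (\<Sum>i<n. p i * a i j) = p j"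
    and simple: "\<And>u. (\<And>i. i < n \<Longrightarrow> act n a u i = u i) \<Longrightarrow> (\<Sum>i<n. of_real (p i) * u i) = 0
      \<Longrightarrow> \<forall>i<n. u i = 0"
    and px: "(\<Sum>i<n. of_real (p i) * x i) = 0"
  shows "N x \<le> (3 ^ length \<mu>s - 1) / \<delta> * N (\<lambda>i. z * x i - act n a x i)"
proof (rule resolvent_bound[OF z \<open>0 < \<delta>\<close> gap])
  let ?F = "\<lambda>es. foldr (\<lambda>m u i. act n a u i - m * u i) es x"
  have p0: "(\<Sum>i<n. of_real (p i) * ?F es i) = 0" for es
  proof (induction es)
    case (Cons e es)
    have "(\<Sum>i<n. of_real (p i) * ?F (e # es) i)
        = (\<Sum>i<n. of_real (p i) * act n a (?F es) i) - e * (\<Sum>i<n. of_real (p i) * ?F es i)"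
      by (simp add: right_diff_distrib sum_subtractf sum_distrib_left mult.left_commute[of e])
    then show ?case using Cons sum_act_left[of n p a, OF left] by simp
  qed (use px in simp)
  have "vec n (?F (1 # \<mu>s)) = 0\<^sub>v n"
    unfolding vec_foldr_act by (rule char_poly_roots_annihilate[OF _ cp]) simp_all
  then have "act n a (?F \<mu>s) i = ?F \<mu>s i" if "i < n" for i
    using that by (auto dest!: arg_cong[of _ _ "\<lambda>v. v $ i"])
  then show "N (?F \<mu>s) = 0" unfolding N_zero by (rule simple) (use p0 in auto)
qed

end

section \<open>The two norms contracted by stochastic matrices\<close>

definition l1 :: "nat \<Rightarrow> (nat \<Rightarrow> complex) \<Rightarrow> real" where
  "l1 n u = (\<Sum>i<n. cmod (u i))"

definition linf :: "nat \<Rightarrow> (nat \<Rightarrow> complex) \<Rightarrow> real" where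
  "linf n u = Max ((\<lambda>i. cmod (u i)) ` {..<n})"

lemma l1_triangle: "l1 n (\<lambda>i. u i + v i) \<le> l1 n u + l1 n v"
  unfolding l1_def sum.distrib[symmetric] by (intro sum_mono norm_triangle_ineq)

lemma l1_scale: "l1 n (\<lambda>i. c * u i) = cmod c * l1 n u"
  by (simp add: l1_def norm_mult sum_distrib_left)

lemma l1_matrix_contraction:
  assumes nonneg: "\<And>i j. i < n \<Longrightarrow> j < n \<Longrightarrow> 0 \<le> b i j"
    and col: "\<And>j. j < n \<Longrightarrow> (\<Sum>i<n. b i j) = 1"
  shows "matrix_contraction n b (l1 n)"
proof
  fix u v :: "nat \<Rightarrow> complex" and c :: complex
  show "l1 n (\<lambda>i. u i + v i) \<le> l1 n u + l1 n v"
    by (rule l1_triangle)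
  show "l1 n (\<lambda>i. c * u i) = cmod c * l1 n u"
    by (rule l1_scale)
  show "l1 n u = 0 \<longleftrightarrow> (\<forall>i<n. u i = 0)"
    by (auto simp: l1_def sum_nonneg_eq_0_iff)
  have "l1 n (act n b u) \<le> (\<Sum>i<n. \<Sum>j<n. b i j * cmod (u j))"
    unfolding l1_def act_def
    by (intro sum_mono order.trans[OF norm_sum] sum_mono) (simp add: norm_mult nonneg)
  also have "\<dots> = (\<Sum>j<n. (\<Sum>i<n. b i j) * cmod (u j))"
    by (subst sum.swap) (simp add: sum_distrib_right)
  finally show "l1 n (act n b u) \<le> l1 n u" using col by (simp add: l1_def)
qed

lemma linf_ge: "i < n \<Longrightarrow> cmod (u i) \<le> linf n u"
  unfolding linf_def by simp

lemma linf_le_iff: "0 < n \<Longrightarrow> linf n u \<le> c \<longleftrightarrow> (\<forall>i<n. cmod (u i) \<le> c)"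
  unfolding linf_def by (subst Max_le_iff) auto

lemma linf_nonneg: "0 < n \<Longrightarrow> 0 \<le> linf n u"
  using linf_ge[of 0 n u] norm_ge_zero[of "u 0"] by linarith

lemma linf_matrix_contraction:
  assumes nonneg: "\<And>i j. i < n \<Longrightarrow> j < n \<Longrightarrow> 0 \<le> a i j" and "0 < n"
    and row: "\<And>i. i < n \<Longrightarrow> (\<Sum>j<n. a i j) = 1"
  shows "matrix_contraction n a (linf n)"
proof
  fix u v :: "nat \<Rightarrow> complex" and c :: complex
  show "linf n (\<lambda>i. u i + v i) \<le> linf n u + linf n v"
    unfolding linf_le_iff[OF \<open>0 < n\<close>]
    by (auto intro!: order.trans[OF norm_triangle_ineq] add_mono linf_ge)
  show "linf n (\<lambda>i. c * u i) = cmod c * linf n u"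
  proof (rule antisym)
    show "linf n (\<lambda>i. c * u i) \<le> cmod c * linf n u"
      unfolding linf_le_iff[OF \<open>0 < n\<close>] by (auto simp: norm_mult intro!: mult_left_mono linf_ge)
    show "cmod c * linf n u \<le> linf n (\<lambda>i. c * u i)"
    proof (cases "c = 0")
      case False
      have "linf n u \<le> linf n (\<lambda>i. c * u i) / cmod c"
        unfolding linf_le_iff[OF \<open>0 < n\<close>]
        using False linf_ge[of _ n "\<lambda>i. c * u i"] by (auto simp: field_simps norm_mult)
      then show ?thesis using False by (simp add: field_simps)
    qed (use linf_nonneg[OF \<open>0 < n\<close>] in simp)
  qed
  have "linf n u = 0 \<longleftrightarrow> linf n u \<le> 0" using linf_nonneg[OF \<open>0 < n\<close>, of u] by auto
  then show "linf n u = 0 \<longleftrightarrow> (\<forall>i<n. u i = 0)" by (simp add: linf_le_iff[OF \<open>0 < n\<close>])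
  show "linf n (act n a u) \<le> linf n u"
    unfolding linf_le_iff[OF \<open>0 < n\<close>]
  proof (intro allI impI)
    fix i assume i: "i < n"
    have "cmod (act n a u i) \<le> (\<Sum>j<n. a i j * linf n u)"
      unfolding act_def
      by (intro order.trans[OF norm_sum] sum_mono) (simp add: norm_mult nonneg i mult_left_mono linf_ge)
    also have "\<dots> = linf n u" using row[OF i] by (simp flip: sum_distrib_right)
    finally show "cmod (act n a u i) \<le> linf n u" .
  qed
qed

section \<open>Peripheral eigenvectors\<close>

lemma act_const: "(\<Sum>j<n. a i j) = 1 \<Longrightarrow> act n a (\<lambda>_. c) i = c"
  by (simp add: act_def flip: sum_distrib_right of_real_sum)

lemma l1_triangle_diff: "l1 n (\<lambda>i. u i - v i) \<le> l1 n u + l1 n v"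
  unfolding l1_def sum.distrib[symmetric] by (intro sum_mono norm_triangle_ineq4)

lemma l1_cong: "(\<And>i. i < n \<Longrightarrow> u i = v i) \<Longrightarrow> l1 n u = l1 n v"
  by (simp add: l1_def)

lemma cmod_le_l1: "i < n \<Longrightarrow> cmod (u i) \<le> l1 n u"
  unfolding l1_def by (rule member_le_sum) auto

lemma cmod_sum_le_l1: "cmod (\<Sum>i<n. u i) \<le> l1 n u"
  unfolding l1_def by (rule norm_sum)

lemma cmod_average_le_l1:
  assumes "\<And>i. i < n \<Longrightarrow> 0 \<le> p i" "\<And>i. i < n \<Longrightarrow> p i \<le> 1"
  shows "cmod (\<Sum>i<n. of_real (p i) * u i) \<le> l1 n u"
  unfolding l1_def
proof (rule order.trans[OF norm_sum sum_mono])
  fix i assume "i \<in> {..<n}"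
  then show "cmod (of_real (p i) * u i) \<le> cmod (u i)"
    using assms[of i] mult_right_mono[of "p i" 1 "cmod (u i)"] by (simp add: norm_mult)
qed

text \<open>
  Put \<open>x = \<xi> 1 + x'\<close> and \<open>y = s v + y'\<close> with \<open>x'\<close>, \<open>y'\<close> in the complements of the Perron vectors.
  The equations then give \<open>X \<le> 16 n \<epsilon> R (1 + R) X\<close> for \<open>X = |\<xi>| + |x'|\<close>.  The equation for \<open>\<xi>\<close> is
  divided by \<open>z - 1 + t\<close> with \<open>0 < t \<le> 1\<close>; as \<open>1 \<le> |z|\<close>, its modulus dominates both \<open>t\<close>
  and \<open>|z - 1| / 2\<close>, so that eigenvalues near (or equal to) \<open>1\<close> need no separate treatment.
\<close>

lemma no_peripheral_eigenvector:
  fixes x y :: "nat \<Rightarrow> complex" and a b :: "nat \<Rightarrow> nat \<Rightarrow> real"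
  assumes "0 < n"
    and p_pos: "\<And>i. i < n \<Longrightarrow> 0 < p i" and p_sum: "(\<Sum>i<n. p i) = 1"
    and p_left: "\<And>j. j < n \<Longrightarrow> (\<Sum>i<n. p i * a i j) = p j"
    and v_pos: "\<And>i. i < n \<Longrightarrow> 0 < v i" and v_sum: "(\<Sum>i<n. v i) = 1"
    and v_right: "\<And>i. i < n \<Longrightarrow> (\<Sum>j<n. b i j * v j) = v i"
    and row: "\<And>i. i < n \<Longrightarrow> (\<Sum>j<n. a i j) = 1"
    and col: "\<And>j. j < n \<Longrightarrow> (\<Sum>i<n. b i j) = 1"
    and b_contr: "\<And>u. l1 n (act n b u) \<le> l1 n u"
    and RA: "\<And>u. (\<Sum>i<n. of_real (p i) * u i) = 0 \<Longrightarrow> linf n u \<le> R * linf n (\<lambda>i. z * u i - act n a u i)"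
    and RB: "\<And>u. (\<Sum>i<n. u i) = 0 \<Longrightarrow> l1 n u \<le> R * l1 n (\<lambda>i. z * u i - act n b u i)"
    and R: "0 \<le> R" and eps: "0 < \<epsilon>" "\<epsilon> * n \<le> 1" and small: "16 * n * \<epsilon> * R * (1 + R) < 1"
    and z: "1 \<le> cmod z"
    and eq1: "\<And>i. i < n \<Longrightarrow> z * x i - act n a x i = of_real \<epsilon> * y i"
    and eq2: "\<And>i. i < n \<Longrightarrow> z * y i - act n b y i = (1 - z) * x i"
    and sum0: "(\<Sum>i<n. x i) + (\<Sum>i<n. y i) = 0"
    and "i < n"
  shows "x i = 0 \<and> y i = 0"
proof -
  have p_le: "p i \<le> 1" if "i < n" for i
    using member_le_sum[of i "{..<n}" p] that p_pos p_sum by (auto simp: less_imp_le)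
  have p_nn: "0 \<le> p i" if "i < n" for i using p_pos[OF that] by simp
  define \<xi> where "\<xi> = (\<Sum>i<n. of_real (p i) * x i)"
  define x' where "x' i = x i - \<xi>" for i
  define s where "s = (\<Sum>i<n. y i)"
  define V where "V i = complex_of_real (v i)" for i
  define y' where "y' i = y i - s * V i" for i
  \<comment> \<open>The total of \<open>x\<close> is \<open>-s\<close>, so this is \<open>x\<close>
    moved into the space of total 0. It arises from the equations:
    \<open>(z - B) y' = (1 - z) xt\<close>.\<close>
  define xt where "xt i = x i + s * V i" for i
  define \<eta> where "\<eta> = (\<Sum>i<n. of_real (p i) * y i)"
  define X' where "X' = linf n x'"
  define X where "X = cmod \<xi> + X'"
  define Y where "Y = l1 n y"
  have V_sum: "(\<Sum>i<n. V i) = 1" using v_sum by (simp add: V_def flip: of_real_sum)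
  have V_right: "act n b V i = V i" if "i < n" for i
    using v_right[OF that] by (simp add: V_def act_def flip: of_real_mult of_real_sum)
  have V_l1: "l1 n V = 1"
    using v_sum v_pos by (simp add: l1_def V_def sum.cong[of _ _ "\<lambda>i. \<bar>v i\<bar>" v] less_imp_le)
  have X'0: "0 \<le> X'" unfolding X'_def by (rule linf_nonneg[OF \<open>0 < n\<close>])
  then have X0: "0 \<le> X" unfolding X_def by simp

  have xi_eq: "(z - 1) * \<xi> = of_real \<epsilon> * \<eta>"
  proof -
    have "(\<Sum>i<n. of_real (p i) * (z * x i - act n a x i)) = (\<Sum>i<n. of_real (p i) * (of_real \<epsilon> * y i))"
      using eq1 by simp
    then have "z * \<xi> - (\<Sum>i<n. of_real (p i) * act n a x i) = of_real \<epsilon> * \<eta>"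
      unfolding \<xi>_def \<eta>_def
      by (simp add: right_diff_distrib sum_subtractf sum_distrib_left mult.left_commute)
    then show ?thesis
      using sum_act_left[of n p a x] p_left by (simp add: \<xi>_def algebra_simps)
  qed

  have "X' \<le> R * linf n (\<lambda>i. z * x' i - act n a x' i)"
    unfolding X'_def
  proof (rule RA)
    show "(\<Sum>i<n. of_real (p i) * x' i) = 0"
      using p_sum unfolding x'_def
      by (simp add: right_diff_distrib sum_subtractf \<xi>_def flip: sum_distrib_right of_real_sum)
  qed
  also have "linf n (\<lambda>i. z * x' i - act n a x' i) \<le> 2 * \<epsilon> * Y"
    unfolding linf_le_iff[OF \<open>0 < n\<close>]
  proof (intro allI impI)
    fix i assume i: "i < n"
    have "act n a x' i = act n a x i - \<xi>"
      using act_lin[of n a 1 x "-1" "\<lambda>_. \<xi>"] act_const[where a = a and i = i and n = n and c = \<xi>] row[OF i]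
      by (simp add: x'_def[abs_def] fun_eq_iff)
    then have "z * x' i - act n a x' i = of_real \<epsilon> * y i - (z - 1) * \<xi>"
      using eq1[OF i] by (simp add: x'_def algebra_simps)
    also have "\<dots> = of_real \<epsilon> * (y i - \<eta>)" unfolding xi_eq by (simp add: algebra_simps)
    also have "cmod \<dots> \<le> \<epsilon> * (Y + Y)"
      using norm_triangle_ineq4[of "y i" \<eta>] cmod_le_l1[OF i, of y]
        cmod_average_le_l1[of n p y, OF p_nn p_le] eps
      by (simp add: norm_mult Y_def \<eta>_def mult_left_mono)
    finally show "cmod (z * x' i - act n a x' i) \<le> 2 * \<epsilon> * Y" by simp
  qed
  finally have X'_le: "X' \<le> R * (2 * \<epsilon> * Y)" using R by (simp add: mult_left_mono)

  have s: "s = - (\<Sum>i<n. x i)" using sum0 by (simp add: s_def eq_neg_iff_add_eq_0 add.commute)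
  have s_le: "cmod s \<le> l1 n x" unfolding s using cmod_sum_le_l1[of x n] by simp
  have xt_sum: "(\<Sum>i<n. xt i) = 0"
  proof -
    have "(\<Sum>i<n. xt i) = (\<Sum>i<n. x i) + s * (\<Sum>i<n. V i)"
      by (simp add: xt_def sum.distrib sum_distrib_left)
    then show ?thesis using V_sum s by simp
  qed
  have y'_sum: "(\<Sum>i<n. y' i) = 0"
    using V_sum unfolding y'_def by (simp add: sum_subtractf s_def flip: sum_distrib_left)
  have xt_l1: "l1 n xt \<le> 2 * l1 n x"
    using l1_triangle[of n x "\<lambda>i. s * V i"] s_le by (simp add: xt_def[abs_def] l1_scale V_l1)
  have y'_eq: "z * y' i - act n b y' i = (1 - z) * xt i" if "i < n" for i
  proof -
    have "act n b y' i = act n b y i - s * V i"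
      using act_lin[of n b 1 y "-s" V] V_right[OF that] by (simp add: y'_def[abs_def] fun_eq_iff)
    then show ?thesis using eq2[OF that] by (simp add: y'_def xt_def algebra_simps)
  qed
  \<comment> \<open>Two estimates of \<open>y'\<close> are needed. This one keeps the factor
    \<open>|z - 1|\<close>, which is compared with \<open>d\<close> in the equation for
    \<open>\<xi>\<close>.\<close>
  have "l1 n y' \<le> R * l1 n (\<lambda>i. z * y' i - act n b y' i)"
    by (rule RB) (rule y'_sum)
  also have "l1 n (\<lambda>i. z * y' i - act n b y' i) = cmod (z - 1) * l1 n xt"
    using y'_eq by (simp add: l1_cong[of n _ "\<lambda>i. (1 - z) * xt i"] l1_scale norm_minus_commute)
  also have "\<dots> \<le> cmod (z - 1) * (2 * l1 n x)" by (intro mult_left_mono xt_l1) simp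
  finally have y'_le1: "l1 n y' \<le> R * (cmod (z - 1) * (2 * l1 n x))" using R by (simp add: mult_left_mono)

  \<comment> \<open>Nothing bounds \<open>|z - 1|\<close> from above. Adding \<open>xt\<close> turns
    the right-hand side into \<open>xt - B xt\<close>, so the second estimate of \<open>y'\<close>
    is uniform in \<open>z\<close>.\<close>
  have "l1 n (\<lambda>i. y' i + xt i) \<le> R * l1 n (\<lambda>i. z * (y' i + xt i) - act n b (\<lambda>i. y' i + xt i) i)"
    by (rule RB) (simp add: sum.distrib xt_sum y'_sum)
  also have "l1 n (\<lambda>i. z * (y' i + xt i) - act n b (\<lambda>i. y' i + xt i) i) = l1 n (\<lambda>i. xt i - act n b xt i)"
  proof (rule l1_cong)
    fix i assume i: "i < n"
    have "act n b (\<lambda>i. y' i + xt i) i = act n b y' i + act n b xt i"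
      using act_lin[of n b 1 y' 1 xt] by (simp add: fun_eq_iff)
    then show "z * (y' i + xt i) - act n b (\<lambda>i. y' i + xt i) i = xt i - act n b xt i"
      using y'_eq[OF i] by (simp add: algebra_simps)
  qed
  also have "\<dots> \<le> 4 * l1 n x"
    using l1_triangle_diff[of n xt "act n b xt"] b_contr[of xt] xt_l1 by simp
  finally have w_le: "l1 n (\<lambda>i. y' i + xt i) \<le> R * (4 * l1 n x)" using R by (simp add: mult_left_mono)
  have "l1 n y' \<le> l1 n (\<lambda>i. y' i + xt i) + l1 n xt"
    using l1_triangle_diff[of n "\<lambda>i. y' i + xt i" xt] by simp
  then have y'_le2: "l1 n y' \<le> (4 * R + 2) * l1 n x" using w_le xt_l1 by (simp add: algebra_simps)

  have x_le: "l1 n x \<le> n * X"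
  proof -
    have "cmod (x i) \<le> X" if "i < n" for i
      using norm_triangle_ineq[of "x' i" \<xi>] linf_ge[OF that, of x'] by (simp add: x'_def X_def X'_def)
    then have "l1 n x \<le> (\<Sum>i<n. X)" unfolding l1_def by (intro sum_mono) auto
    then show ?thesis by simp
  qed
  have "Y \<le> l1 n y' + l1 n (\<lambda>i. s * V i)"
    using l1_triangle[of n y' "\<lambda>i. s * V i"] by (simp add: Y_def y'_def)
  then have "Y \<le> (4 * R + 3) * l1 n x"
    using y'_le2 s_le by (simp add: l1_scale V_l1 algebra_simps)
  also have "\<dots> \<le> (4 * R + 3) * (n * X)" using R x_le by (intro mult_left_mono) auto
  finally have Y_le: "Y \<le> (4 * R + 3) * (n * X)" .

  \<comment> \<open>Expanding \<open>\<eta>\<close> and then \<open>s\<close> produces the term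
    \<open>- \<epsilon> c n \<xi>\<close>; moved to the left it becomes the shift \<open>t\<close>.
    It is positive because both Perron vectors are, and at most 1 because
    \<open>\<epsilon> n \<le> 1\<close>.\<close>
  define c where "c = (\<Sum>i<n. p i * v i)"
  define t where "t = \<epsilon> * c * n"
  have "0 < c" unfolding c_def using \<open>0 < n\<close> p_pos v_pos by (intro sum_pos) auto
  have "c \<le> (\<Sum>i<n. v i)" unfolding c_def
    using p_le v_pos by (intro sum_mono) (auto simp: mult_le_cancel_right1 less_imp_le)
  then have "c \<le> 1" using v_sum by simp
  have t0: "0 < t" using \<open>0 < c\<close> eps \<open>0 < n\<close> by (simp add: t_def)
  have t1: "t \<le> 1"
    using mult_mono[OF eps(2) \<open>c \<le> 1\<close>] \<open>0 < c\<close> by (simp add: t_def mult.commute mult.left_commute)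
  define d where "d = cmod (z - 1 + of_real t)"
  have d_ge: "t \<le> d"
    using norm_triangle_ineq2[of z "of_real (1 - t)"] z t1 by (simp add: d_def norm_of_real algebra_simps del: of_real_diff)
      (simp add: algebra_simps)
  have "cmod (z - 1) \<le> d + t"
    using norm_triangle_ineq4[of "z - 1 + of_real t" "of_real t"] t0 by (simp add: d_def)
  then have z1_le: "cmod (z - 1) \<le> 2 * d" using d_ge by simp

  have eta_eq: "\<eta> = (\<Sum>i<n. of_real (p i) * y' i) + s * of_real c"
    by (simp add: \<eta>_def y'_def V_def c_def right_diff_distrib sum_subtractf sum_distrib_left
        mult.commute mult.left_commute)
  have s_eq: "s = - of_nat n * \<xi> - (\<Sum>i<n. x' i)"
    by (simp add: s x'_def sum_subtractf)
  have "(z - 1 + of_real t) * \<xi> = of_real \<epsilon> * \<eta> + of_real t * \<xi>"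
    using xi_eq by (simp add: algebra_simps)
  also have "\<dots> = of_real \<epsilon> * (\<Sum>i<n. of_real (p i) * y' i) - of_real (\<epsilon> * c) * (\<Sum>i<n. x' i)"
    unfolding eta_eq s_eq t_def by (simp add: algebra_simps)
  finally have "(z - 1 + of_real t) * \<xi> =
      of_real \<epsilon> * (\<Sum>i<n. of_real (p i) * y' i) - of_real (\<epsilon> * c) * (\<Sum>i<n. x' i)" .
  then have "d * cmod \<xi> = cmod (of_real \<epsilon> * (\<Sum>i<n. of_real (p i) * y' i) - of_real (\<epsilon> * c) * (\<Sum>i<n. x' i))"
    unfolding d_def by (simp only: norm_mult[symmetric])
  also have "\<dots> \<le> \<epsilon> * cmod (\<Sum>i<n. of_real (p i) * y' i) + \<epsilon> * c * cmod (\<Sum>i<n. x' i)"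
    by (rule order.trans[OF norm_triangle_ineq4]) (use eps \<open>0 < c\<close> in \<open>simp add: norm_mult\<close>)
  also have "\<dots> \<le> \<epsilon> * (R * (cmod (z - 1) * (2 * (n * X)))) + \<epsilon> * c * (n * X')"
  proof (intro add_mono mult_left_mono)
    have "cmod (\<Sum>i<n. of_real (p i) * y' i) \<le> l1 n y'"
      by (rule cmod_average_le_l1) (use p_nn p_le in auto)
    also have "\<dots> \<le> R * (cmod (z - 1) * (2 * l1 n x))" by (rule y'_le1)
    also have "\<dots> \<le> R * (cmod (z - 1) * (2 * (n * X)))"
      using R x_le by (intro mult_left_mono) auto
    finally show "cmod (\<Sum>i<n. of_real (p i) * y' i) \<le> R * (cmod (z - 1) * (2 * (n * X)))" .
    have "cmod (\<Sum>i<n. x' i) \<le> (\<Sum>i<n. X')"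
      unfolding X'_def by (intro order.trans[OF norm_sum] sum_mono linf_ge) simp
    then show "cmod (\<Sum>i<n. x' i) \<le> n * X'" by simp
  qed (use eps \<open>0 < c\<close> in auto)
  also have "\<dots> \<le> \<epsilon> * (R * (2 * d * (2 * (n * X)))) + d * X'"
  proof (intro add_mono mult_left_mono mult_right_mono)
    show "\<epsilon> * c * (n * X') \<le> d * X'"
      using mult_right_mono[OF d_ge X'0] by (simp add: t_def mult.assoc)
  qed (use eps R X0 z1_le in auto)
  also have "\<dots> = d * (4 * \<epsilon> * R * n * X + X')" by (simp add: algebra_simps)
  finally have "cmod \<xi> \<le> 4 * \<epsilon> * R * n * X + X'"
    using d_ge t0 by (subst (asm) mult_le_cancel_left_pos) auto
  then have "X \<le> 4 * \<epsilon> * R * n * X + 2 * X'" unfolding X_def by simp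
  also have "X' \<le> R * (2 * \<epsilon> * ((4 * R + 3) * (n * X)))"
    using X'_le Y_le R eps by (meson mult_left_mono order.trans less_imp_le mult_nonneg_nonneg zero_le_numeral)
  \<comment> \<open>The coefficients add up to
    \<open>4 + 2 * 2 * (4 R + 3) = 16 (1 + R)\<close>.\<close>
  finally have "X \<le> (16 * n * \<epsilon> * R * (1 + R)) * X" by (simp add: algebra_simps)
  then have "X = 0" using small X0
    by (smt (verit) mult_right_mono mult_cancel_right1 mult_le_cancel_right1)
  then have "l1 n x \<le> 0" "l1 n y \<le> 0" using x_le Y_le by (auto simp: Y_def)
  then show ?thesis
    using cmod_le_l1[OF \<open>i < n\<close>, of x] cmod_le_l1[OF \<open>i < n\<close>, of y]
    by (meson norm_le_zero_iff order.trans)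
qed

section \<open>The third largest eigenvalue\<close>

lemma proots_prod_linear: "proots (\<Prod>e\<leftarrow>es. [:- e, 1:]) = mset (es :: 'a::idom list)"
proof (induction es)
  case (Cons e es)
  have "(\<Prod>e\<leftarrow>es. [:- e, 1:]) \<noteq> 0" by (auto simp: prod_list_zero_iff)
  then have "proots ([:- e, 1:] * (\<Prod>e\<leftarrow>es. [:- e, 1:])) = proots [:- e, 1:] + proots (\<Prod>e\<leftarrow>es. [:- e, 1:])"
    by (intro proots_mult) auto
  also have "\<dots> = mset (e # es)" unfolding Cons.IH proots_linear_factor by simp
  finally show ?case by (simp only: list.map prod_list.Cons)
qed simp

lemma rev_sorted_list_of_multiset_ones:
  fixes Y :: "real multiset"
  assumes "\<And>y. y \<in># Y \<Longrightarrow> y \<le> 1"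
  shows "rev (sorted_list_of_multiset (add_mset 1 (add_mset 1 Y))) = 1 # 1 # rev (sorted_list_of_multiset Y)"
proof -
  let ?S = "sorted_list_of_multiset Y @ [1, 1]"
  have "sorted ?S" using assms by (auto simp: sorted_append)
  moreover have "mset ?S = add_mset 1 (add_mset 1 Y)" by simp
  ultimately have "sorted_list_of_multiset (add_mset 1 (add_mset 1 Y)) = ?S"
    by (metis sorted_list_of_multiset_mset sorted_sort_id)
  then show ?thesis by simp
qed

lemma le_hd_rev_sorted:
  fixes Y :: "real multiset"
  assumes "y \<in># Y"
  shows "y \<le> rev (sorted_list_of_multiset Y) ! 0"
proof -
  let ?L = "rev (sorted_list_of_multiset Y)"
  have "y \<in> set ?L" using assms by simp
  then obtain i where i: "i < length ?L" "?L ! i = y" by (meson in_set_conv_nth)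
  have "sorted_wrt (\<ge>) ?L" by (simp add: sorted_wrt_rev)
  then show ?thesis
    using i sorted_wrt_nth_less[of "(\<ge>)" ?L 0 i] by (cases "i = 0") simp_all
qed

lemma unit_root_factorization:
  fixes A :: "complex mat"
  assumes A: "A \<in> carrier_mat n n" and ev: "eigenvalue A 1"
  obtains \<mu>s where "char_poly A = (\<Prod>e\<leftarrow>1 # \<mu>s. [:- e, 1:])" "length \<mu>s = n - 1"
proof -
  obtain es where es: "char_poly A = (\<Prod>e\<leftarrow>es. [:- e, 1:])" "length es = n"
    using char_poly_factorized[OF A] by blast
  have "poly (char_poly A) 1 = 0" using ev eigenvalue_root_char_poly[OF A] by simp
  then have "1 \<in> set es" unfolding es(1) by (auto simp: poly_prod_list prod_list_zero_iff)
  then obtain xs ys where xy: "es = xs @ 1 # ys" by (meson split_list)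
  show ?thesis
  proof (rule that[of "xs @ ys"])
    show "char_poly A = (\<Prod>e\<leftarrow>1 # xs @ ys. [:- e, 1:])"
      unfolding es(1) xy by (simp only: map_append list.map prod_list.append prod_list.Cons mult.left_commute)
  qed (use es(2) xy in simp)
qed

lemma map_mat_of_real: "A \<in> carrier_mat n n \<Longrightarrow> map_mat complex_of_real A = cmat n (\<lambda>i j. A $$ (i, j))"
  by (intro eq_matI) (auto simp: cmat_def)

text \<open>At \<open>\<epsilon> = 0\<close> the matrix is block triangular, so its roots are those
  of \<open>A\<close> together with those of \<open>B\<close>. The two roots 1 split off here fill
  the first two places of the sorted list, whatever ties there are, and the third entry is the
  maximum of the rest.\<close>

lemma abs_lambda3_bounds:
  assumes A: "A \<in> carrier_mat n n" and B: "B \<in> carrier_mat n n"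
    and cpA: "char_poly (map_mat complex_of_real A) = (\<Prod>e\<leftarrow>1 # \<mu>s. [:- e, 1:])"
    and cpB: "char_poly (map_mat complex_of_real B) = (\<Prod>e\<leftarrow>1 # \<nu>s. [:- e, 1:])"
    and le1: "\<And>e. e \<in> set \<mu>s \<union> set \<nu>s \<Longrightarrow> cmod e \<le> 1"
  shows "\<And>e. e \<in> set \<mu>s \<union> set \<nu>s \<Longrightarrow> cmod e \<le> abs_lambda3 (M_mat n A B 0)"
    and "0 \<le> abs_lambda3 (M_mat n A B 0)" "abs_lambda3 (M_mat n A B 0) \<le> 1"
proof -
  let ?c = "map_mat complex_of_real" and ?M = "M_mat n A B 0"
  have M: "?c ?M = four_block_mat (?c A) (0\<^sub>m n n) (?c (1\<^sub>m n - A)) (?c B)"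
  proof -
    have "?M = four_block_mat A (0\<^sub>m n n) (1\<^sub>m n - A) B"
      unfolding M_mat_def using A B by (intro cong_four_block_mat) auto
    then show ?thesis using A B by (simp add: map_four_block_mat[of _ n n _ n _ n]) (auto intro!: cong_four_block_mat)
  qed
  have "char_poly (?c ?M) = char_poly (?c A) * char_poly (?c B)"
  proof (rule char_poly_0_block'[OF M])
    show "\<exists>es. char_poly (?c A) = (\<Prod>e\<leftarrow>es. [:- e, 1:])" by (rule exI[of _ "1 # \<mu>s"], rule cpA)
    show "\<exists>es. char_poly (?c B) = (\<Prod>e\<leftarrow>es. [:- e, 1:])" by (rule exI[of _ "1 # \<nu>s"], rule cpB)
  qed (use A B in auto)
  also have "\<dots> = (\<Prod>e\<leftarrow>(1 # \<mu>s) @ (1 # \<nu>s). [:- e, 1:])" 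
    unfolding cpA cpB by (simp only: map_append prod_list.append)
  finally have "proots (char_poly (?c ?M)) = mset ((1 # \<mu>s) @ (1 # \<nu>s))"
    by (simp only: proots_prod_linear)
  then have roots: "image_mset cmod (proots (char_poly (?c ?M)))
      = add_mset 1 (add_mset 1 (image_mset cmod (mset (\<mu>s @ \<nu>s))))" by simp
  define Y where "Y = image_mset cmod (mset (\<mu>s @ \<nu>s))"
  have Y1: "y \<le> 1" if "y \<in># Y" for y using that le1 by (auto simp: Y_def)
  have moduli: "eigenvalue_moduli ?M = 1 # 1 # rev (sorted_list_of_multiset Y)"
    unfolding eigenvalue_moduli_def roots Y_def[symmetric]
    using rev_sorted_list_of_multiset_ones[of Y] Y1 by simp
  \<comment> \<open>An empty \<open>Y\<close> means that no roots remain besides the two split off;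
    this is the default case of \<open>abs_lambda3\<close>.\<close>
  have lam: "abs_lambda3 ?M = (if Y = {#} then 0 else rev (sorted_list_of_multiset Y) ! 0)"
  proof (cases "Y = {#}")
    case False
    then have "sorted_list_of_multiset Y \<noteq> []" by (metis mset_sorted_list_of_multiset mset_zero_iff)
    then have "1 \<le> length (sorted_list_of_multiset Y)" by (simp add: Suc_le_eq)
    then show ?thesis using False by (simp add: abs_lambda3_def moduli numeral_2_eq_2)
  qed (simp add: abs_lambda3_def moduli)
  show "cmod e \<le> abs_lambda3 ?M" if "e \<in> set \<mu>s \<union> set \<nu>s" for e
  proof -
    have "cmod e \<in># Y" using that by (auto simp: Y_def)
    then show ?thesis using le_hd_rev_sorted[of "cmod e" Y] by (auto simp: lam)
  qed
  show "0 \<le> abs_lambda3 ?M" "abs_lambda3 ?M \<le> 1"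
  proof -
    have "abs_lambda3 ?M \<in># Y" if "Y \<noteq> {#}"
    proof -
      have "sorted_list_of_multiset Y \<noteq> []" using that by (metis mset_sorted_list_of_multiset mset_zero_iff)
      then have "rev (sorted_list_of_multiset Y) ! 0 \<in> set (rev (sorted_list_of_multiset Y))"
        by (intro nth_mem) simp
      then show ?thesis using that by (simp add: lam)
    qed
    then show "0 \<le> abs_lambda3 ?M" "abs_lambda3 ?M \<le> 1"
      using Y1 by (auto simp: lam Y_def split: if_splits)
  qed
qed

text \<open>For \<open>n \<ge> 2\<close>, \<open>R (1 + R)\<close> is at most
  \<open>9^(n-1) / \<delta>^2\<close>, while \<open>20 + 8 n \<ge> 36\<close> and
  \<open>\<delta>^n \<le> \<delta>^2\<close>, and \<open>36^n\<close> outweighs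
  \<open>16 n 9^(n-1)\<close>. For \<open>n = 1\<close> only one power of \<open>\<delta>\<close> is
  available, but then \<open>R = 0\<close>.\<close>

lemma exponential_gap_bound:
  assumes "0 < n" and d: "0 < \<delta>" "\<delta> \<le> 1"
    and eps: "0 < \<epsilon>" "\<epsilon> < 1 / (20 + 8 * real n) ^ n * \<delta> ^ n"
    and R: "R = (3 ^ (n - 1) - 1) / \<delta>"
  shows "16 * n * \<epsilon> * R * (1 + R) < 1" "\<epsilon> * n \<le> 1"
proof -
  have "\<delta> ^ n \<le> 1" using d by (simp add: power_le_one)
  then have "1 / (20 + 8 * real n) ^ n * \<delta> ^ n \<le> 1 / (20 + 8 * real n) ^ n * 1"
    by (intro mult_left_mono) auto
  moreover have "real n \<le> (20 + 8 * real n) ^ n"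
    using self_le_power[of "20 + 8 * real n" n] \<open>0 < n\<close> by simp
  then have "1 / (20 + 8 * real n) ^ n \<le> 1 / real n"
    using \<open>0 < n\<close> by (intro divide_left_mono) auto
  ultimately have "\<epsilon> \<le> 1 / real n" using eps by linarith
  then show "\<epsilon> * n \<le> 1" using \<open>0 < n\<close> by (simp add: field_simps)
  show "16 * n * \<epsilon> * R * (1 + R) < 1"
  proof (cases "n = 1")
    case True
    then show ?thesis by (simp add: R)
  next
    case False
    then have n2: "2 \<le> n" using \<open>0 < n\<close> by simp
    have R0: "0 \<le> R" and R1: "R \<le> 3 ^ (n - 1) / \<delta>" and R2: "1 + R \<le> 3 ^ (n - 1) / \<delta>"
      unfolding R using d by (auto simp: field_simps)
    have nine: "(3::real) ^ (n - 1) * 3 ^ (n - 1) = 9 ^ (n - 1)"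
      by (simp flip: power_mult_distrib)
    have "R * (1 + R) \<le> 3 ^ (n - 1) / \<delta> * (3 ^ (n - 1) / \<delta>)"
      using R0 R1 R2 d by (intro mult_mono) auto
    also have "\<dots> = 9 ^ (n - 1) / \<delta>\<^sup>2" by (simp only: times_divide_times_eq power2_eq_square nine)
    finally have RR: "R * (1 + R) \<le> 9 ^ (n - 1) / \<delta>\<^sup>2" .
    have "1 / (20 + 8 * real n) ^ n * \<delta> ^ n \<le> 1 / 36 ^ n * \<delta>\<^sup>2"
    proof (rule mult_mono)
      show "1 / (20 + 8 * real n) ^ n \<le> 1 / 36 ^ n"
        using n2 by (intro divide_left_mono power_mono) auto
      show "\<delta> ^ n \<le> \<delta>\<^sup>2" using d n2 by (intro power_decreasing) auto
    qed (use d in auto)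
    then have e: "\<epsilon> < \<delta>\<^sup>2 / 36 ^ n" using eps by simp
    have num: "16 * real n * 9 ^ (n - 1) \<le> 36 ^ n"
      using \<open>0 < n\<close>
    proof (induction n rule: nat_induct_non_zero)
      case (Suc m)
      define q :: real where "q = 9 ^ (m - 1)"
      have q: "9 ^ m = 9 * q" using Suc by (simp add: q_def flip: power_Suc)
      have "real (Suc m) * q \<le> (2 * real m) * q"
        using Suc by (intro mult_right_mono) (auto simp: q_def)
      then have "16 * real (Suc m) * 9 ^ m \<le> 18 * (16 * real m * q)" unfolding q by (simp add: algebra_simps)
      also have "\<dots> \<le> 18 * 36 ^ m" using Suc by (simp add: q_def)
      also have "(18::real) * 36 ^ m \<le> 36 ^ Suc m" by simp
      finally show ?case by simp
    qed simp
    have "16 * n * \<epsilon> * R * (1 + R) = 16 * n * \<epsilon> * (R * (1 + R))" by simp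
    also have "\<dots> \<le> 16 * n * \<epsilon> * (9 ^ (n - 1) / \<delta>\<^sup>2)"
      using RR eps by (intro mult_left_mono) auto
    also have "\<dots> = (16 * real n * 9 ^ (n - 1)) * (\<epsilon> / \<delta>\<^sup>2)" by simp
    also have "\<dots> < (16 * real n * 9 ^ (n - 1)) * (1 / 36 ^ n)"
      using e d \<open>0 < n\<close> by (intro mult_strict_left_mono) (auto simp: field_simps)
    also have "\<dots> \<le> 36 ^ n * (1 / 36 ^ n)" by (rule mult_right_mono[OF num]) simp
    finally show ?thesis by simp
  qed
qed

lemma sum_lessThan_double: "(\<Sum>j<2 * n. f j) = (\<Sum>j<n. f j) + (\<Sum>j<n. f (n + j))"
  for f :: "nat \<Rightarrow> 'a::comm_monoid_add"
proof -
  have "(\<Sum>j<n + m. f j) = (\<Sum>j<n. f j) + (\<Sum>j<m. f (n + j))" for m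
    by (induction m) (auto simp: add.assoc)
  then show ?thesis by (simp add: mult_2)
qed

section \<open>Block entries and deflation of the eigenvalue 1\<close>

lemma M_mat_index:
  assumes "A \<in> carrier_mat n n" "B \<in> carrier_mat n n" "i < n" "j < n"
  shows "M_mat n A B \<epsilon> $$ (i, j) = A $$ (i, j)"
    and "M_mat n A B \<epsilon> $$ (i, n + j) = (if i = j then \<epsilon> else 0)"
    and "M_mat n A B \<epsilon> $$ (n + i, j) = (if i = j then 1 else 0) - A $$ (i, j)"
    and "M_mat n A B \<epsilon> $$ (n + i, n + j) = B $$ (i, j) - (if i = j then \<epsilon> else 0)"
  using assms by (auto simp: M_mat_def)

text \<open>
  \<open>M\<close> has the right eigenvector \<open>[1; 0]\<close> and the left eigenvector \<open>[1, 1]\<close> for the eigenvalue \<open>1\<close>;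
  subtracting their normalized product moves this eigenvalue to \<open>0\<close>.
\<close>

definition deflated_mat :: "nat \<Rightarrow> real mat \<Rightarrow> real mat \<Rightarrow> real \<Rightarrow> real mat" where
  "deflated_mat n A B \<epsilon> =
     mat (2 * n) (2 * n) (\<lambda>(i, j). M_mat n A B \<epsilon> $$ (i, j) - (if i < n then 1 / real n else 0))"

text \<open>The entries of \<open>w\<close> lie in any real vector space, because the formulas are
  applied both to complex eigenvectors and to the deviations of the iterates.\<close>

lemma deflated_mat_sum:
  fixes A B :: "real mat" and w :: "nat \<Rightarrow> 'b::real_vector"
  assumes "A \<in> carrier_mat n n" "B \<in> carrier_mat n n" "i < n"
  shows "(\<Sum>j<2 * n. (deflated_mat n A B \<epsilon> $$ (i, j)) *\<^sub>R w j) =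
      (\<Sum>j<n. (A $$ (i, j)) *\<^sub>R w j) + \<epsilon> *\<^sub>R w (n + i) - (1 / real n) *\<^sub>R (\<Sum>j<2 * n. w j)" (is ?t)
    and "(\<Sum>j<2 * n. (deflated_mat n A B \<epsilon> $$ (n + i, j)) *\<^sub>R w j) =
      w i - (\<Sum>j<n. (A $$ (i, j)) *\<^sub>R w j) + (\<Sum>j<n. (B $$ (i, j)) *\<^sub>R w (n + j)) - \<epsilon> *\<^sub>R w (n + i)" (is ?b)
proof -
  have delta: "(\<Sum>j<n. (if i = j then c else 0) *\<^sub>R u j) = c *\<^sub>R (u i :: 'b)" for c u
  proof -
    have "(\<Sum>j<n. (if i = j then c else 0) *\<^sub>R u j) = (\<Sum>j<n. if j = i then c *\<^sub>R u j else 0)"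
      by (intro sum.cong) auto
    then show ?thesis using \<open>i < n\<close> by simp
  qed
  define r where "r = 1 / real n"
  have D: "deflated_mat n A B \<epsilon> $$ (k, l) = M_mat n A B \<epsilon> $$ (k, l) - (if k < n then r else 0)"
    if "k < 2 * n" "l < 2 * n" for k l
    using that by (simp add: deflated_mat_def r_def)
  have "(\<Sum>j<n. (deflated_mat n A B \<epsilon> $$ (i, j)) *\<^sub>R w j) = (\<Sum>j<n. (A $$ (i, j)) *\<^sub>R w j) - r *\<^sub>R (\<Sum>j<n. w j)"
    using assms by (simp add: D M_mat_index scaleR_left_diff_distrib sum_subtractf scaleR_sum_right)
  moreover have "(\<Sum>j<n. (deflated_mat n A B \<epsilon> $$ (i, n + j)) *\<^sub>R w (n + j)) = \<epsilon> *\<^sub>R w (n + i) - r *\<^sub>R (\<Sum>j<n. w (n + j))"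
    using assms by (simp add: D M_mat_index scaleR_left_diff_distrib sum_subtractf scaleR_sum_right delta)
  ultimately show ?t
    unfolding sum_lessThan_double r_def[symmetric] by (simp add: scaleR_add_right)
  have "(\<Sum>j<n. (deflated_mat n A B \<epsilon> $$ (n + i, j)) *\<^sub>R w j) = w i - (\<Sum>j<n. (A $$ (i, j)) *\<^sub>R w j)"
    using assms by (simp add: D M_mat_index scaleR_left_diff_distrib sum_subtractf delta)
  moreover have "(\<Sum>j<n. (deflated_mat n A B \<epsilon> $$ (n + i, n + j)) *\<^sub>R w (n + j)) =
      (\<Sum>j<n. (B $$ (i, j)) *\<^sub>R w (n + j)) - \<epsilon> *\<^sub>R w (n + i)"
    using assms by (simp add: D M_mat_index scaleR_left_diff_distrib sum_subtractf delta)
  ultimately show ?b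
    unfolding sum_lessThan_double by simp
qed

section \<open>Geometric decay\<close>

text \<open>The columns of the deflated matrix sum to 0, which forces total 0 on an eigenvector for
  \<open>z \<noteq> 0\<close>. The subtracted rank-one term then vanishes on it, so it is an
  eigenvector of \<open>M\<close> itself.\<close>

lemma deflated_mat_eigenvalue_less_1:
  assumes net: "network n E" and sc: "strongly_connected n E"
    and rw: "row_weights n E A" and cw: "col_weights n E B"
    and eps: "\<epsilon> \<in> {0<..<Upsilon n A B}"
    and ev: "eigenvalue (map_mat complex_of_real (deflated_mat n A B \<epsilon>)) z"
  shows "cmod z < 1"
proof (rule ccontr)
  assume "\<not> cmod z < 1"
  then have z: "1 \<le> cmod z" by simp
  define a where "a i j = A $$ (i, j)" for i j
  define b where "b i j = B $$ (i, j)" for i j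
  have n: "0 < n" and E: "E \<subseteq> {..<n} \<times> {..<n}" using net by (auto simp: network_def)
  have A: "A \<in> carrier_mat n n" and B: "B \<in> carrier_mat n n"
    using rw cw by (auto simp: row_weights_def col_weights_def)
  have row: "(\<Sum>j<n. a i j) = 1" if "i < n" for i
    using rw that by (simp add: row_weights_def a_def)
  have col: "(\<Sum>i<n. b i j) = 1" if "j < n" for j
    using cw that by (simp add: col_weights_def b_def)
  have a_entry: "if (i, j) \<in> E then 0 < a i j else a i j = 0" if "i < n" "j < n" for i j
    using rw that by (simp add: row_weights_def a_def in_nbrs_def split: if_splits)
  have b_entry: "if (i, j) \<in> E then 0 < b i j else b i j = 0" if "i < n" "j < n" for i j
    using cw that by (simp add: col_weights_def b_def out_nbrs_def split: if_splits)
  have a_nn: "0 \<le> a i j" and b_nn: "0 \<le> b i j" if "i < n" "j < n" for i j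
    using a_entry[OF that] b_entry[OF that] by (auto split: if_splits)
  have irrA: "irreducible_nonneg n E a"
    unfolding irreducible_nonneg_def
  proof (intro conjI allI impI ballI)
    fix e assume e: "e \<in> E"
    then show "case e of (i, j) \<Rightarrow> 0 < a i j"
      using E a_entry[of "fst e" "snd e"] by (cases e) auto
  qed (use n E sc a_nn in auto)
  have irrB: "irreducible_nonneg n E b"
    unfolding irreducible_nonneg_def
  proof (intro conjI allI impI ballI)
    fix e assume e: "e \<in> E"
    then show "case e of (i, j) \<Rightarrow> 0 < b i j"
      using E b_entry[of "fst e" "snd e"] by (cases e) auto
  qed (use n E sc b_nn in auto)
  \<comment> \<open>The left Perron vector of \<open>a\<close> is obtained as the right one of its
    transpose.\<close>
  have irrAt: "irreducible_nonneg n (E\<inverse>) (\<lambda>i j. a j i)"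
    using irrA unfolding irreducible_nonneg_def strongly_connected_def
    by (auto simp: rtrancl_converse)
  obtain p where p: "\<forall>i<n. 0 < p i" "(\<Sum>i<n. p i) = 1" "\<forall>i<n. (\<Sum>j<n. a j i * p j) = p i"
    using perron_vector_exists[OF irrAt row] by blast
  then have p: "\<And>i. i < n \<Longrightarrow> 0 < p i" "(\<Sum>i<n. p i) = 1"
      "\<And>j. j < n \<Longrightarrow> (\<Sum>i<n. p i * a i j) = p j"
    by (simp_all add: mult.commute)
  obtain v where v: "\<forall>i<n. 0 < v i" "(\<Sum>i<n. v i) = 1" "\<forall>i<n. (\<Sum>j<n. b i j * v j) = v i"
    using perron_vector_exists[OF irrB col] by blast
  interpret A: matrix_contraction n a "linf n"
    by (rule linf_matrix_contraction) (use a_nn n row in auto)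
  interpret B: matrix_contraction n b "l1 n"
    by (rule l1_matrix_contraction) (use b_nn col in auto)

  have "(cmat n a)\<^sup>T = cmat n (\<lambda>i j. a j i)" by (auto simp: cmat_def)
  moreover have "eigenvalue (cmat n (\<lambda>i j. a j i)) 1"
  proof (rule column_stochastic_eigenvalue_1[OF _ n])
    show "(\<Sum>i<n. cmat n (\<lambda>i j. a j i) $$ (i, j)) = 1" if "j < n" for j
      using row[OF that] that by (simp add: cmat_def flip: of_real_sum)
  qed simp
  ultimately have "eigenvalue (cmat n a) 1"
    using eigenvalue_root_char_poly[of "cmat n a" n] eigenvalue_root_char_poly[of "(cmat n a)\<^sup>T" n]
      char_poly_transpose_mat[of "cmat n a" n]
    by simp
  then obtain \<mu>s where \<mu>s: "char_poly (cmat n a) = (\<Prod>e\<leftarrow>1 # \<mu>s. [:- e, 1:])" "length \<mu>s = n - 1"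
    using unit_root_factorization[of "cmat n a" n] by auto
  have "eigenvalue (cmat n b) 1"
  proof (rule column_stochastic_eigenvalue_1[OF _ n])
    show "(\<Sum>i<n. cmat n b $$ (i, j)) = 1" if "j < n" for j
      using col[OF that] that by (simp add: cmat_def flip: of_real_sum)
  qed simp
  then obtain \<nu>s where \<nu>s: "char_poly (cmat n b) = (\<Prod>e\<leftarrow>1 # \<nu>s. [:- e, 1:])" "length \<nu>s = n - 1"
    using unit_root_factorization[of "cmat n b" n] by auto
  have le1: "cmod e \<le> 1" if "e \<in> set \<mu>s \<union> set \<nu>s" for e
  proof (cases "e \<in> set \<mu>s")
    case True
    then have "poly (char_poly (cmat n a)) e = 0" unfolding \<mu>s by (simp add: poly_prod_list prod_list_zero_iff)
    then show ?thesis using A.eigenvalue_le_1 eigenvalue_root_char_poly[of "cmat n a" n] by simp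
  next
    case False
    then have "poly (char_poly (cmat n b)) e = 0" using that unfolding \<nu>s by (simp add: poly_prod_list prod_list_zero_iff)
    then show ?thesis using B.eigenvalue_le_1 eigenvalue_root_char_poly[of "cmat n b" n] by simp
  qed
  have cpA: "char_poly (map_mat complex_of_real A) = (\<Prod>e\<leftarrow>1 # \<mu>s. [:- e, 1:])"
    using \<mu>s map_mat_of_real[OF A] by (simp add: a_def[abs_def])
  have cpB: "char_poly (map_mat complex_of_real B) = (\<Prod>e\<leftarrow>1 # \<nu>s. [:- e, 1:])"
    using \<nu>s map_mat_of_real[OF B] by (simp add: b_def[abs_def])
  define \<delta> where "\<delta> = 1 - abs_lambda3 (M_mat n A B 0)"
  have eps0: "0 < \<epsilon>" and eps1: "\<epsilon> < 1 / (20 + 8 * real n) ^ n * \<delta> ^ n"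
    using eps by (auto simp: Upsilon_def \<delta>_def)
  \<comment> \<open>The gap is a consequence, not a hypothesis: \<open>|\<lambda>3| = 1\<close>
    would make \<open>Upsilon\<close> zero and leave no admissible
    \<open>\<epsilon>\<close>.\<close>
  have "\<delta> \<noteq> 0" using eps0 eps1 n by (auto simp: zero_power)
  then have d: "0 < \<delta>" "\<delta> \<le> 1" using abs_lambda3_bounds(2,3)[OF A B cpA cpB] le1 by (simp_all add: \<delta>_def)
  have gap: "cmod e \<le> 1 - \<delta>" if "e \<in> set \<mu>s \<union> set \<nu>s" for e
    using abs_lambda3_bounds(1)[OF A B cpA cpB _ that] le1 by (simp add: \<delta>_def)
  define R where "R = (3 ^ (n - 1) - 1) / \<delta>"
  note small = exponential_gap_bound[OF n d eps0 eps1 R_def]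
  have R0: "0 \<le> R" using d by (simp add: R_def)
  have RA: "linf n u \<le> R * linf n (\<lambda>i. z * u i - act n a u i)"
    if "(\<Sum>i<n. of_real (p i) * u i) = 0" for u
  proof -
    have "linf n u \<le> (3 ^ length \<mu>s - 1) / \<delta> * linf n (\<lambda>i. z * u i - act n a u i)"
    proof (rule A.complement_resolvent_bound[OF \<mu>s(1) z d(1) _ p(3) _ that])
      fix w assume w: "\<And>i. i < n \<Longrightarrow> act n a w i = w i" "(\<Sum>i<n. of_real (p i) * w i) = 0"
      show "\<forall>i<n. w i = 0"
      proof (intro allI impI)
        fix i assume "i < n"
        show "w i = 0"
          by (rule row_stochastic_fixed[OF irrA _ _ p(2) w(2) \<open>i < n\<close>])
            (simp_all only: row w(1) flip: act_def)
      qed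
    qed (use gap in auto)
    then show ?thesis by (simp add: R_def \<mu>s(2))
  qed
  have RB: "l1 n u \<le> R * l1 n (\<lambda>i. z * u i - act n b u i)" if "(\<Sum>i<n. u i) = 0" for u
  proof -
    have "l1 n u \<le> (3 ^ length \<nu>s - 1) / \<delta> * l1 n (\<lambda>i. z * u i - act n b u i)"
    proof (rule B.complement_resolvent_bound[OF \<nu>s(1) z d(1), where p = "\<lambda>_. 1"])
      fix w assume w: "\<And>i. i < n \<Longrightarrow> act n b w i = w i" "(\<Sum>i<n. of_real 1 * w i) = 0"
      have w0: "(\<Sum>i<n. w i) = 0" using w(2) by simp
      show "\<forall>i<n. w i = 0"
      proof (intro allI impI)
        fix i assume "i < n"
        show "w i = 0"
          by (rule column_stochastic_fixed_sum_zero[OF irrB _ _ w0 \<open>i < n\<close>])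
            (simp_all only: col w(1) flip: act_def)
      qed
    qed (use gap col that in auto)
    then show ?thesis by (simp add: R_def \<nu>s(2))
  qed

  let ?M = "map_mat complex_of_real (deflated_mat n A B \<epsilon>)"
  obtain w where "eigenvector ?M w z" using ev unfolding eigenvalue_def by blast
  then have w: "w \<in> carrier_vec (2 * n)" "w \<noteq> 0\<^sub>v (2 * n)" "?M *\<^sub>v w = z \<cdot>\<^sub>v w"
    by (auto simp: eigenvector_def deflated_mat_def)
  define x where "x i = w $ i" for i
  define y where "y i = w $ (n + i)" for i
  define s where "s = (\<Sum>i<n. x i) + (\<Sum>i<n. y i)"
  have Mw: "(\<Sum>j<2 * n. (deflated_mat n A B \<epsilon> $$ (i, j)) *\<^sub>R w $ j) = z * w $ i" if "i < 2 * n" for i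
  proof -
    have "(?M *\<^sub>v w) $ i = (\<Sum>j<2 * n. (deflated_mat n A B \<epsilon> $$ (i, j)) *\<^sub>R w $ j)"
      using that w(1) by (simp add: scalar_prod_def deflated_mat_def lessThan_atLeast0 scaleR_conv_of_real)
    then show ?thesis using w that by simp
  qed
  have actA: "(\<Sum>j<n. (A $$ (i, j)) *\<^sub>R w $ j) = act n a x i" for i
    by (simp add: act_def a_def x_def scaleR_conv_of_real)
  have actB: "(\<Sum>j<n. (B $$ (i, j)) *\<^sub>R w $ (n + j)) = act n b y i" for i
    by (simp add: act_def b_def y_def scaleR_conv_of_real)
  have s_eq: "(\<Sum>j<2 * n. w $ j) = s" unfolding sum_lessThan_double s_def x_def y_def ..
  have top: "z * x i = act n a x i + of_real \<epsilon> * y i - of_real (1 / n) * s" if "i < n" for i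
    using Mw[of i] that deflated_mat_sum(1)[OF A B that, of \<epsilon> "($) w"] unfolding actA s_eq
    by (simp add: x_def y_def scaleR_conv_of_real)
  have bot: "z * y i = x i - act n a x i + act n b y i - of_real \<epsilon> * y i" if "i < n" for i
    using Mw[of "n + i"] that deflated_mat_sum(2)[OF A B that, of \<epsilon> "($) w"] unfolding actA actB
    by (simp add: x_def y_def scaleR_conv_of_real)
  have "z * s = (\<Sum>i<n. z * x i + z * y i)"
    by (simp add: s_def sum.distrib sum_distrib_left distrib_left)
  also have "\<dots> = (\<Sum>i<n. x i + act n b y i - of_real (1 / n) * s)"
    by (intro sum.cong refl) (simp add: top bot)
  also have "\<dots> = (\<Sum>i<n. x i) + (\<Sum>i<n. act n b y i) - s"
    using n by (simp add: sum_subtractf sum.distrib)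
  also have "(\<Sum>i<n. act n b y i) = (\<Sum>i<n. y i)"
    using sum_act_left[of n "\<lambda>_. 1" b y] col by simp
  finally have "z * s = 0" by (simp add: s_def)
  then have s0: "s = 0" using z by auto
  have sum0: "(\<Sum>i<n. x i) + (\<Sum>i<n. y i) = 0" using s0 by (simp add: s_def)
  have v': "\<And>i. i < n \<Longrightarrow> 0 < v i" "\<And>i. i < n \<Longrightarrow> (\<Sum>j<n. b i j * v j) = v i"
    using v by auto
  have "x i = 0 \<and> y i = 0" if "i < n" for i
  proof (rule no_peripheral_eigenvector[where a = a and b = b and p = p and v = v and R = R and z = z and \<epsilon> = \<epsilon> and n = n])
    show "z * x i - act n a x i = of_real \<epsilon> * y i" if "i < n" for i
      using top[OF that] s0 by simp
    show "z * y i - act n b y i = (1 - z) * x i" if "i < n" for i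
      using top[OF that] bot[OF that] s0 by (simp add: algebra_simps)
  qed (fact n p v' v(2) row col B.act_contr RA RB R0 eps0 small z sum0 that)+
  then have xy: "w $ i = 0" "w $ (n + i) = 0" if "i < n" for i
    using that by (auto simp: x_def y_def)
  have "w = 0\<^sub>v (2 * n)"
  proof (rule eq_vecI)
    fix i assume "i < dim_vec (0\<^sub>v (2 * n) :: complex vec)"
    then show "w $ i = 0\<^sub>v (2 * n) $ i"
      using xy(1)[of i] xy(2)[of "i - n"] by (cases "i < n") auto
  qed (use w in auto)
  then show False using w(2) by simp
qed

lemma smult_pow_mat:
  fixes C :: "'a::comm_ring_1 mat"
  assumes C: "C \<in> carrier_mat m m"
  shows "(c \<cdot>\<^sub>m C) ^\<^sub>m k = c ^ k \<cdot>\<^sub>m (C ^\<^sub>m k)"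
proof (induction k)
  case 0
  then show ?case using C by (intro eq_matI) auto
next
  case (Suc k)
  have "(c ^ k \<cdot>\<^sub>m (C ^\<^sub>m k)) * (c \<cdot>\<^sub>m C) = c \<cdot>\<^sub>m ((c ^ k \<cdot>\<^sub>m (C ^\<^sub>m k)) * C)"
    using C by (intro mult_smult_distrib) auto
  also have "(c ^ k \<cdot>\<^sub>m (C ^\<^sub>m k)) * C = c ^ k \<cdot>\<^sub>m (C ^\<^sub>m k * C)"
    using C by (intro mult_smult_assoc_mat) auto
  finally show ?case using Suc C by (auto intro!: eq_matI simp: ac_simps)
qed

text \<open>Dividing by some \<open>\<gamma>\<close> strictly between the spectral radius and 1
  leaves spectral radius below 1, hence bounded powers. Multiplying back gives pure geometric decay;
  at the rate of the spectral radius itself, Jordan blocks could add polynomial factors.\<close>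

lemma geometric_power_bound:
  fixes M :: "real mat"
  assumes M: "M \<in> carrier_mat m m" and "0 < m"
    and ev: "\<And>z. eigenvalue (map_mat complex_of_real M) z \<Longrightarrow> cmod z < 1"
  shows "\<exists>c \<gamma>. 0 < \<gamma> \<and> \<gamma> < 1 \<and> 0 \<le> c \<and>
    (\<forall>k. \<forall>i<m. \<forall>j<m. \<bar>(M ^\<^sub>m k) $$ (i, j)\<bar> \<le> c * \<gamma> ^ k)"
proof -
  let ?C = "map_mat complex_of_real M"
  have C: "?C \<in> carrier_mat m m" using M by simp
  define \<rho> where "\<rho> = spectral_radius ?C"
  obtain z where "z \<in> spectrum ?C" "cmod z = \<rho>"
    using spectral_radius_mem_max(1)[OF C \<open>0 < m\<close>] by (auto simp: \<rho>_def)
  then have \<rho>: "0 \<le> \<rho>" "\<rho> < 1" using ev by (auto simp: spectrum_def)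
  define \<gamma> where "\<gamma> = (1 + \<rho>) / 2"
  have \<gamma>: "0 < \<gamma>" "\<gamma> < 1" "\<rho> < \<gamma>" using \<rho> by (auto simp: \<gamma>_def)
  define G where "G = complex_of_real (1 / \<gamma>) \<cdot>\<^sub>m ?C"
  have G: "G \<in> carrier_mat m m" using M by (simp add: G_def)
  have "spectral_radius G < 1"
  proof -
    obtain u where u: "u \<in> spectrum G" "cmod u = spectral_radius G"
      using spectral_radius_mem_max(1)[OF G \<open>0 < m\<close>] by auto
    then obtain v where "eigenvector G v u" by (auto simp: spectrum_def eigenvalue_def)
    then have v: "v \<in> carrier_vec m" "v \<noteq> 0\<^sub>v m" "G *\<^sub>v v = u \<cdot>\<^sub>v v"
      using G by (auto simp: eigenvector_def)
    have "?C *\<^sub>v v = (of_real \<gamma> * u) \<cdot>\<^sub>v v"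
    proof (rule eq_vecI)
      fix i assume "i < dim_vec ((of_real \<gamma> * u) \<cdot>\<^sub>v v)"
      then have i: "i < m" using v by simp
      have "(G *\<^sub>v v) $ i = of_real (1 / \<gamma>) * (?C *\<^sub>v v) $ i"
        using i v(1) M by (simp add: G_def scalar_prod_def sum_distrib_left sum_divide_distrib)
      then have "u * v $ i = of_real (1 / \<gamma>) * (?C *\<^sub>v v) $ i" using v i by simp
      then show "(?C *\<^sub>v v) $ i = ((of_real \<gamma> * u) \<cdot>\<^sub>v v) $ i"
        using i v(1) \<gamma>(1) by (simp add: field_simps)
    qed (use v M in auto)
    then have "eigenvalue ?C (of_real \<gamma> * u)"
      using v M by (auto simp: eigenvalue_def eigenvector_def)
    then have "cmod (of_real \<gamma> * u) \<le> \<rho>"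
      unfolding \<rho>_def by (intro spectral_radius_mem_max(2)[OF C \<open>0 < m\<close>]) (auto simp: spectrum_def)
    then have "\<gamma> * cmod u \<le> \<rho>" using \<gamma>(1) by (simp add: norm_mult)
    then have "\<gamma> * cmod u < \<gamma> * 1" using \<gamma>(3) by linarith
    then have "cmod u < 1" using \<gamma>(1) by (simp only: mult_less_cancel_left_pos)
    then show ?thesis using u(2) by simp
  qed
  then obtain c where c: "norm_bound (G ^\<^sub>m k) c" for k
    using spectral_radius_jnf_norm_bound_less_1_upper_triangular[OF G] by blast
  have bound: "\<bar>(M ^\<^sub>m k) $$ (i, j)\<bar> \<le> c * \<gamma> ^ k" if ij: "i < m" "j < m" for k i j
  proof -
    have "?C ^\<^sub>m k = map_mat of_real (M ^\<^sub>m k)"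
      by (rule of_real_hom.mat_hom_pow[OF M, symmetric])
    then have "(G ^\<^sub>m k) $$ (i, j) = of_real ((1 / \<gamma>) ^ k * (M ^\<^sub>m k) $$ (i, j))"
      unfolding G_def smult_pow_mat[OF C] using ij M by simp
    moreover have "cmod ((G ^\<^sub>m k) $$ (i, j)) \<le> c"
      using c[of k] ij G unfolding norm_bound_def by simp
    ultimately have "\<bar>(1 / \<gamma>) ^ k * (M ^\<^sub>m k) $$ (i, j)\<bar> \<le> c"
      by (simp only: norm_of_real)
    then have "(1 / \<gamma>) ^ k * \<bar>(M ^\<^sub>m k) $$ (i, j)\<bar> \<le> c"
      using \<gamma>(1) by (simp add: abs_mult)
    then show ?thesis using \<gamma>(1) by (simp add: power_one_over field_simps)
  qed
  have "0 \<le> c" using bound[of 0 0 0] \<open>0 < m\<close> abs_ge_zero order.trans by fastforce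
  then show ?thesis using \<gamma>(1,2) bound by blast
qed

section \<open>Perturbed recursions and step-size sums\<close>

text \<open>The initial value \<open>1\<close> accounts for the deviation of the starting vectors.\<close>

primrec discounted_sum :: "real \<Rightarrow> (nat \<Rightarrow> real) \<Rightarrow> nat \<Rightarrow> real" where
  "discounted_sum \<gamma> \<alpha> 0 = 1"
| "discounted_sum \<gamma> \<alpha> (Suc k) = \<gamma> * discounted_sum \<gamma> \<alpha> k + \<alpha> k"

lemma discounted_sum_nonneg:
  assumes "0 \<le> \<gamma>" "\<And>k. 0 \<le> \<alpha> k"
  shows "0 \<le> discounted_sum \<gamma> \<alpha> k"
  using assms by (induction k) auto

lemma perturbed_linear_recursion_bound:
  fixes e d :: "nat \<Rightarrow> nat \<Rightarrow> 'b::real_normed_vector" and M :: "real mat"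
  assumes M: "M \<in> carrier_mat m m" and g: "0 < \<gamma>" and c: "0 \<le> c"
    and pow: "\<And>k i j. i < m \<Longrightarrow> j < m \<Longrightarrow> \<bar>(M ^\<^sub>m k) $$ (i, j)\<bar> \<le> c * \<gamma> ^ k"
    and rec: "\<And>k i. i < m \<Longrightarrow> e (Suc k) i = (\<Sum>j<m. (M $$ (i, j)) *\<^sub>R e k j) + d k i"
    and d: "\<And>k i. i < m \<Longrightarrow> norm (d k i) \<le> H * \<alpha> k"
    and al: "\<And>k. 0 \<le> \<alpha> k" and H: "0 \<le> H"
  obtains C where "0 \<le> C" "\<And>k i. i < m \<Longrightarrow> norm (e k i) \<le> C * discounted_sum \<gamma> \<alpha> k"
proof -
  \<comment> \<open>\<open>discounted_sum\<close> starts at 1 and gains \<open>\<alpha> k\<close> in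
    each step, so the constant has to dominate both the initial norms and the noise level.\<close>
  define C where "C = (\<Sum>j<m. norm (e 0 j)) + m * H"
  have C0: "0 \<le> C" using H by (auto simp: C_def intro!: add_nonneg_nonneg sum_nonneg)
  have s0: "0 \<le> discounted_sum \<gamma> \<alpha> k" for k using g al by (intro discounted_sum_nonneg) auto
  have weighted: "norm (\<Sum>j<m. ((M ^\<^sub>m q) $$ (i, j)) *\<^sub>R u j) \<le> c * \<gamma> ^ q * (\<Sum>j<m. norm (u j))"
    if "i < m" for q i and u :: "nat \<Rightarrow> 'b"
  proof -
    have "norm (\<Sum>j<m. ((M ^\<^sub>m q) $$ (i, j)) *\<^sub>R u j) \<le> (\<Sum>j<m. c * \<gamma> ^ q * norm (u j))"
      using pow[OF that] by (intro order.trans[OF norm_sum] sum_mono) (simp add: mult_right_mono)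
    then show ?thesis by (simp add: sum_distrib_left)
  qed
  \<comment> \<open>Inducting on all powers of \<open>M\<close> at once replaces unrolling the recursion.\<close>
  have main: "norm (\<Sum>j<m. ((M ^\<^sub>m q) $$ (i, j)) *\<^sub>R e k j) \<le> c * \<gamma> ^ q * (C * discounted_sum \<gamma> \<alpha> k)"
    if "i < m" for k q i
    using that
  proof (induction k arbitrary: q)
    case 0
    have "(\<Sum>j<m. norm (e 0 j)) \<le> C" using H by (simp add: C_def)
    then have "c * \<gamma> ^ q * (\<Sum>j<m. norm (e 0 j)) \<le> c * \<gamma> ^ q * C"
      using c g by (intro mult_left_mono) auto
    then show ?case using weighted[OF 0, of q "e 0"] by simp
  next
    case (Suc k)
    have "(\<Sum>j<m. ((M ^\<^sub>m q) $$ (i, j)) *\<^sub>R (\<Sum>l<m. (M $$ (j, l)) *\<^sub>R e k l))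
        = (\<Sum>j<m. \<Sum>l<m. ((M ^\<^sub>m q) $$ (i, j) * M $$ (j, l)) *\<^sub>R e k l)"
      by (simp add: scaleR_sum_right)
    also have "\<dots> = (\<Sum>l<m. \<Sum>j<m. ((M ^\<^sub>m q) $$ (i, j) * M $$ (j, l)) *\<^sub>R e k l)"
      by (rule sum.swap)
    also have "\<dots> = (\<Sum>l<m. ((M ^\<^sub>m Suc q) $$ (i, l)) *\<^sub>R e k l)"
      using M Suc.prems by (intro sum.cong refl)
        (simp add: scalar_prod_def lessThan_atLeast0 scaleR_sum_left)
    finally have "(\<Sum>j<m. ((M ^\<^sub>m q) $$ (i, j)) *\<^sub>R e (Suc k) j)
        = (\<Sum>l<m. ((M ^\<^sub>m Suc q) $$ (i, l)) *\<^sub>R e k l) + (\<Sum>j<m. ((M ^\<^sub>m q) $$ (i, j)) *\<^sub>R d k j)"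
      by (simp add: rec scaleR_add_right sum.distrib)
    then have "norm (\<Sum>j<m. ((M ^\<^sub>m q) $$ (i, j)) *\<^sub>R e (Suc k) j)
        \<le> norm (\<Sum>l<m. ((M ^\<^sub>m Suc q) $$ (i, l)) *\<^sub>R e k l) + norm (\<Sum>j<m. ((M ^\<^sub>m q) $$ (i, j)) *\<^sub>R d k j)"
      by (simp only: norm_triangle_ineq)
    also have "\<dots> \<le> c * \<gamma> ^ Suc q * (C * discounted_sum \<gamma> \<alpha> k) + c * \<gamma> ^ q * (C * \<alpha> k)"
    proof (rule add_mono)
      show "norm (\<Sum>l<m. ((M ^\<^sub>m Suc q) $$ (i, l)) *\<^sub>R e k l) \<le> c * \<gamma> ^ Suc q * (C * discounted_sum \<gamma> \<alpha> k)"
        by (rule Suc.IH[OF Suc.prems])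
      have "(\<Sum>j<m. norm (d k j)) \<le> (\<Sum>j<m. H * \<alpha> k)" using d by (intro sum_mono) auto
      also have "\<dots> = (m * H) * \<alpha> k" by simp
      also have "\<dots> \<le> C * \<alpha> k" using al by (intro mult_right_mono) (auto simp: C_def sum_nonneg)
      finally have "c * \<gamma> ^ q * (\<Sum>j<m. norm (d k j)) \<le> c * \<gamma> ^ q * (C * \<alpha> k)"
        using c g by (intro mult_left_mono) auto
      then show "norm (\<Sum>j<m. ((M ^\<^sub>m q) $$ (i, j)) *\<^sub>R d k j) \<le> c * \<gamma> ^ q * (C * \<alpha> k)"
        using weighted[OF Suc.prems, of q "d k"] by linarith
    qed
    also have "\<dots> = c * \<gamma> ^ q * (C * discounted_sum \<gamma> \<alpha> (Suc k))" by (simp add: algebra_simps)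
    finally show ?case .
  qed
  show ?thesis
  proof (rule that[of "c * C"])
    fix k i assume i: "i < m"
    have "(\<Sum>j<m. ((M ^\<^sub>m 0) $$ (i, j)) *\<^sub>R e k j) = (\<Sum>j<m. if j = i then e k j else 0)"
      using M i by (intro sum.cong) auto
    then have "(\<Sum>j<m. ((M ^\<^sub>m 0) $$ (i, j)) *\<^sub>R e k j) = e k i" using i by simp
    then show "norm (e k i) \<le> c * C * discounted_sum \<gamma> \<alpha> k"
      using main[OF i, of 0 k] by (simp add: mult.assoc)
  qed (use c C0 in simp)
qed

lemma sum_discounted_sum_le:
  assumes g: "0 < \<gamma>" "\<gamma> < 1" and al: "\<And>k. 0 \<le> \<alpha> k"
    and dec: "\<And>k. 1 \<le> k \<Longrightarrow> \<alpha> (Suc k) \<le> \<alpha> k" and "1 \<le> K"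
  shows "(\<Sum>k=1..K. \<alpha> k * discounted_sum \<gamma> \<alpha> k) \<le>
      (\<alpha> 1 * discounted_sum \<gamma> \<alpha> 1 + (\<Sum>k=1..K. (\<alpha> k)\<^sup>2)) / (1 - \<gamma>)"
proof -
  let ?s = "discounted_sum \<gamma> \<alpha>"
  have s0: "0 \<le> ?s k" for k using g al by (intro discounted_sum_nonneg) auto
  \<comment> \<open>The extra term on the left is what the estimate of
    \<open>\<alpha> (Suc K) * ?s (Suc K)\<close> by \<open>\<gamma> * (\<alpha> K * ?s K)\<close>
    plus the square of \<open>\<alpha> K\<close> uses up in the next step. The sums start at 1
    because \<open>\<alpha>\<close> is known to decrease only from there.\<close>
  have "(1 - \<gamma>) * (\<Sum>k=1..K. \<alpha> k * ?s k) + \<gamma> * (\<alpha> K * ?s K) \<le> \<alpha> 1 * ?s 1 + (\<Sum>k=1..<K. (\<alpha> k)\<^sup>2)"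
    using \<open>1 \<le> K\<close>
  proof (induction K rule: dec_induct)
    case base
    then show ?case by (simp add: algebra_simps)
  next
    case (step K)
    have "\<alpha> (Suc K) * ?s (Suc K) \<le> \<alpha> K * ?s (Suc K)"
      using dec[OF step(1)] s0[of "Suc K"] by (rule mult_right_mono)
    also have "\<dots> = \<gamma> * (\<alpha> K * ?s K) + (\<alpha> K)\<^sup>2" by (simp add: power2_eq_square algebra_simps)
    finally show ?case using step by (simp add: algebra_simps del: discounted_sum.simps)
  qed
  moreover have "0 \<le> \<gamma> * (\<alpha> K * ?s K)" using g al s0 by simp
  moreover have "(\<Sum>k=1..<K. (\<alpha> k)\<^sup>2) \<le> (\<Sum>k=1..K. (\<alpha> k)\<^sup>2)" by (intro sum_mono2) auto
  ultimately have "(1 - \<gamma>) * (\<Sum>k=1..K. \<alpha> k * ?s k) \<le> \<alpha> 1 * ?s 1 + (\<Sum>k=1..K. (\<alpha> k)\<^sup>2)" by linarith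
  then show ?thesis using g by (simp add: field_simps)
qed

section \<open>Growth of the step-size sums\<close>

lemma sum_powr_half_ge:
  assumes "1 \<le> K"
  shows "sqrt (real K) \<le> (\<Sum>k=1..K. real k powr (-1/2))"
proof -
  have "(\<Sum>k=1..K. real K powr (-1/2)) \<le> (\<Sum>k=1..K. real k powr (-1/2))"
    by (intro sum_mono powr_mono2') auto
  moreover have "real K * real K powr (-1/2) = sqrt (real K)"
  proof -
    have "real K * real K powr (-1/2) = real K powr (1 + (-1/2))"
      using assms by (subst powr_add) simp
    then show ?thesis by (simp add: powr_half_sqrt)
  qed
  ultimately show ?thesis by simp
qed

lemma sum_inverse_le_one_plus_ln:
  assumes "1 \<le> K"
  shows "(\<Sum>k=1..K. 1 / real k) \<le> 1 + ln (real K)"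
  using assms
proof (induction K rule: dec_induct)
  case (step K)
  have "ln (real K / real (Suc K)) \<le> real K / real (Suc K) - 1"
    using step(1) by (intro ln_le_minus_one) simp
  also have "\<dots> = - (1 / real (Suc K))" by (simp add: field_simps)
  finally have "1 / real (Suc K) \<le> ln (real (Suc K)) - ln (real K)"
    using step(1) by (simp add: ln_div)
  then show ?case using step by simp
qed simp

section \<open>The subgradient method\<close>

lemma sum_stacked: "(\<Sum>j<2 * n. stacked n x y k j) = (\<Sum>j<n. x k j) + (\<Sum>j<n. y k j)"
  by (simp add: sum_lessThan_double stacked_def)

text \<open>The terms with \<open>A\<close> and with \<open>\<epsilon>\<close> enter
  \<open>x\<close> and \<open>y\<close> with opposite signs and cancel in the total; column sums 1
  preserve the contribution of \<open>B\<close>.\<close>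

lemma D_DGD_zbar_step:
  fixes x y :: "nat \<Rightarrow> nat \<Rightarrow> 'a::real_vector"
  assumes dgd: "D_DGD n A B \<epsilon> \<alpha> g x y"
    and col: "\<And>j. j < n \<Longrightarrow> (\<Sum>i<n. B $$ (i, j)) = 1"
  shows "zbar n x y (Suc k) = zbar n x y k - (\<alpha> k / real n) *\<^sub>R (\<Sum>i<n. g k i (x k i))"
proof -
  have "(\<Sum>j<2 * n. stacked n x y (Suc k) j) = (\<Sum>i<n. x (Suc k) i + y (Suc k) i)"
    by (simp add: sum_stacked sum.distrib)
  also have "\<dots> = (\<Sum>i<n. x k i + (\<Sum>j<n. (B $$ (i, j)) *\<^sub>R y k j) - \<alpha> k *\<^sub>R g k i (x k i))"
    using dgd by (intro sum.cong refl) (simp add: D_DGD_def)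
  also have "\<dots> = (\<Sum>i<n. x k i) + (\<Sum>i<n. \<Sum>j<n. (B $$ (i, j)) *\<^sub>R y k j) - \<alpha> k *\<^sub>R (\<Sum>i<n. g k i (x k i))"
    by (simp add: sum_subtractf sum.distrib scaleR_sum_right)
  also have "(\<Sum>i<n. \<Sum>j<n. (B $$ (i, j)) *\<^sub>R y k j) = (\<Sum>j<n. \<Sum>i<n. (B $$ (i, j)) *\<^sub>R y k j)"
    by (rule sum.swap)
  also have "\<dots> = (\<Sum>j<n. y k j)" using col by (simp flip: scaleR_sum_left)
  finally show ?thesis
    by (simp add: zbar_def sum_stacked scaleR_diff_right)
qed

text \<open>Consensus is a multiple of the right eigenvector \<open>[1; 0]\<close>, so
  \<open>zbar\<close> is subtracted in the \<open>x\<close> block and 0 in the \<open>y\<close>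
  block. The deviation has total 0, hence \<open>M\<close> and the deflated matrix agree on
  it.\<close>

lemma D_DGD_deviation_step:
  fixes x y :: "nat \<Rightarrow> nat \<Rightarrow> 'a::real_vector"
  assumes dgd: "D_DGD n A B \<epsilon> \<alpha> g x y" and "0 < n"
    and A: "A \<in> carrier_mat n n" and B: "B \<in> carrier_mat n n"
    and row: "\<And>i. i < n \<Longrightarrow> (\<Sum>j<n. A $$ (i, j)) = 1"
    and col: "\<And>j. j < n \<Longrightarrow> (\<Sum>i<n. B $$ (i, j)) = 1"
  defines "e \<equiv> \<lambda>k i. stacked n x y k i - (if i < n then zbar n x y k else 0)"
  assumes "i < 2 * n"
  shows "e (Suc k) i = (\<Sum>j<2 * n. (deflated_mat n A B \<epsilon> $$ (i, j)) *\<^sub>R e k j)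
      + (if i < n then \<alpha> k *\<^sub>R ((1 / real n) *\<^sub>R (\<Sum>i<n. g k i (x k i)) - g k i (x k i)) else 0)"
proof -
  let ?z = "zbar n x y k"
  have e_sum: "(\<Sum>j<2 * n. e k j) = 0"
    using \<open>0 < n\<close> unfolding sum_lessThan_double
    by (simp add: e_def stacked_def sum_subtractf zbar_def sum_lessThan_double sum_constant_scaleR)
  have Ae: "(\<Sum>j<n. (A $$ (l, j)) *\<^sub>R e k j) = (\<Sum>j<n. (A $$ (l, j)) *\<^sub>R x k j) - ?z" if "l < n" for l
    using row[OF that]
    by (simp add: e_def stacked_def scaleR_diff_right sum_subtractf flip: scaleR_sum_left)
  have Be: "(\<Sum>j<n. (B $$ (l, j)) *\<^sub>R e k (n + j)) = (\<Sum>j<n. (B $$ (l, j)) *\<^sub>R y k j)" for l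
    by (simp add: e_def stacked_def)
  show ?thesis
  proof (cases "i < n")
    case True
    have "x (Suc k) i = (\<Sum>j<n. (A $$ (i, j)) *\<^sub>R x k j) + \<epsilon> *\<^sub>R y k i - \<alpha> k *\<^sub>R g k i (x k i)"
      using dgd True by (simp add: D_DGD_def)
    then have "e (Suc k) i = (\<Sum>j<n. (A $$ (i, j)) *\<^sub>R x k j) + \<epsilon> *\<^sub>R y k i - \<alpha> k *\<^sub>R g k i (x k i)
        - (?z - (\<alpha> k / real n) *\<^sub>R (\<Sum>i<n. g k i (x k i)))"
      using True D_DGD_zbar_step[OF dgd col] by (simp add: e_def stacked_def)
    moreover have "(\<Sum>j<2 * n. (deflated_mat n A B \<epsilon> $$ (i, j)) *\<^sub>R e k j)
        = (\<Sum>j<n. (A $$ (i, j)) *\<^sub>R x k j) - ?z + \<epsilon> *\<^sub>R y k i"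
      unfolding deflated_mat_sum(1)[OF A B True] e_sum Ae[OF True] by (simp add: e_def stacked_def)
    ultimately show ?thesis using True by (simp add: scaleR_diff_right)
  next
    case False
    then obtain l where l: "i = n + l" "l < n"
      using \<open>i < 2 * n\<close> by (metis add_less_cancel_left le_Suc_ex linorder_not_less mult_2)
    have "(\<Sum>j<2 * n. (deflated_mat n A B \<epsilon> $$ (n + l, j)) *\<^sub>R e k j)
        = e k l - ((\<Sum>j<n. (A $$ (l, j)) *\<^sub>R x k j) - ?z) + (\<Sum>j<n. (B $$ (l, j)) *\<^sub>R y k j) - \<epsilon> *\<^sub>R e k (n + l)"
      unfolding deflated_mat_sum(2)[OF A B l(2)] Ae[OF l(2)] Be ..
    also have "\<dots> = y (Suc k) l"
      using dgd l by (simp add: D_DGD_def e_def stacked_def)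
    finally show ?thesis using l by (simp add: e_def stacked_def)
  qed
qed

lemma D_DGD_consensus:
  fixes x y :: "nat \<Rightarrow> nat \<Rightarrow> 'a::real_normed_vector"
  assumes net: "network n E" and sc: "strongly_connected n E"
    and rw: "row_weights n E A" and cw: "col_weights n E B"
    and eps: "\<epsilon> \<in> {0<..<Upsilon n A B}"
    and dgd: "D_DGD n A B \<epsilon> \<alpha> g x y"
    and al: "\<And>k. 0 \<le> \<alpha> k"
    and g: "\<And>k i u. i < n \<Longrightarrow> norm (g k i u) \<le> D"
  obtains C \<gamma> where "0 \<le> C" "0 < \<gamma>" "\<gamma> < 1"
    "\<And>k i. i < n \<Longrightarrow> norm (x k i - zbar n x y k) \<le> C * discounted_sum \<gamma> \<alpha> k"
proof -
  have n: "0 < n" using net by (simp add: network_def)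
  have A: "A \<in> carrier_mat n n" and B: "B \<in> carrier_mat n n"
    and row: "\<And>i. i < n \<Longrightarrow> (\<Sum>j<n. A $$ (i, j)) = 1"
    and col: "\<And>j. j < n \<Longrightarrow> (\<Sum>i<n. B $$ (i, j)) = 1"
    using rw cw by (auto simp: row_weights_def col_weights_def)
  have M: "deflated_mat n A B \<epsilon> \<in> carrier_mat (2 * n) (2 * n)" by (simp add: deflated_mat_def)
  have "0 \<le> D" using g[OF n] norm_ge_zero order.trans by blast
  obtain c \<gamma> where \<gamma>: "0 < \<gamma>" "\<gamma> < 1" "0 \<le> c" and pow:
    "\<forall>k. \<forall>i<2 * n. \<forall>j<2 * n. \<bar>(deflated_mat n A B \<epsilon> ^\<^sub>m k) $$ (i, j)\<bar> \<le> c * \<gamma> ^ k"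
    using geometric_power_bound[OF M] n deflated_mat_eigenvalue_less_1[OF net sc rw cw eps] by auto
  define e where "e k i = stacked n x y k i - (if i < n then zbar n x y k else 0)" for k i
  define d where "d k i = (if i < n
    then \<alpha> k *\<^sub>R ((1 / real n) *\<^sub>R (\<Sum>i<n. g k i (x k i)) - g k i (x k i)) else 0)" for k i
  have rec: "e (Suc k) i = (\<Sum>j<2 * n. (deflated_mat n A B \<epsilon> $$ (i, j)) *\<^sub>R e k j) + d k i"
    if "i < 2 * n" for k i
    using D_DGD_deviation_step[OF dgd n A B row col that, of k] by (simp add: e_def d_def)
  have d: "norm (d k i) \<le> (2 * D) * \<alpha> k" for k i
  proof (cases "i < n")
    case True
    have "norm (\<Sum>i<n. g k i (x k i)) \<le> (\<Sum>i<n. D)"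
      using g by (intro order.trans[OF norm_sum] sum_mono) auto
    then have "norm ((1 / real n) *\<^sub>R (\<Sum>i<n. g k i (x k i))) \<le> D"
      using n by (simp add: field_simps)
    then have "norm ((1 / real n) *\<^sub>R (\<Sum>i<n. g k i (x k i)) - g k i (x k i)) \<le> D + D"
      using g[OF True] by (intro order.trans[OF norm_triangle_ineq4] add_mono)
    then have "\<alpha> k * norm ((1 / real n) *\<^sub>R (\<Sum>i<n. g k i (x k i)) - g k i (x k i)) \<le> \<alpha> k * (D + D)"
      using al by (intro mult_left_mono)
    moreover have "norm (d k i) = \<alpha> k * norm ((1 / real n) *\<^sub>R (\<Sum>i<n. g k i (x k i)) - g k i (x k i))"
      using True al[of k] by (simp only: d_def if_True norm_scaleR abs_of_nonneg)
    ultimately show ?thesis by (simp add: algebra_simps)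
  qed (use al \<open>0 \<le> D\<close> in \<open>simp add: d_def\<close>)
  obtain C where C: "0 \<le> C" "\<And>k i. i < 2 * n \<Longrightarrow> norm (e k i) \<le> C * discounted_sum \<gamma> \<alpha> k"
    using perturbed_linear_recursion_bound[where e = e and d = d, OF M \<gamma>(1,3) _ rec d al] pow \<open>0 \<le> D\<close> by auto
  show ?thesis
  proof (rule that[OF C(1) \<gamma>(1,2)])
    fix k i assume "i < n"
    then show "norm (x k i - zbar n x y k) \<le> C * discounted_sum \<gamma> \<alpha> k"
      using C(2)[of i k] by (simp add: e_def stacked_def)
  qed
qed

text \<open>\<open>G i\<close> belongs to \<open>xs i\<close>, whereas the decrease is wanted at
  \<open>z\<close>. The inequality at \<open>xs i\<close> is compared with \<open>u\<close>, and the
  one at \<open>z\<close> bounds \<open>f i (xs i)\<close> from below through \<open>Gz i\<close>;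
  each change of point costs \<open>D * r\<close>.\<close>

lemma subgradient_descent_step:
  fixes xs G Gz :: "nat \<Rightarrow> 'a::real_inner" and f :: "nat \<Rightarrow> 'a \<Rightarrow> real"
  assumes "0 < n" and al: "0 \<le> a"
    and sub: "\<And>i. i < n \<Longrightarrow> is_subgradient (f i) (xs i) (G i)"
    and subz: "\<And>i. i < n \<Longrightarrow> is_subgradient (f i) z (Gz i)"
    and G: "\<And>i. i < n \<Longrightarrow> norm (G i) \<le> D" and Gz: "\<And>i. i < n \<Longrightarrow> norm (Gz i) \<le> D"
    and dev: "\<And>i. i < n \<Longrightarrow> norm (xs i - z) \<le> r"
    and z': "z' = z - (a / real n) *\<^sub>R (\<Sum>i<n. G i)"
  shows "2 * a / real n * ((\<Sum>i<n. f i z) - (\<Sum>i<n. f i u))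
    \<le> (norm (z - u))\<^sup>2 - (norm (z' - u))\<^sup>2 + 4 * D * (a * r) + D\<^sup>2 * a\<^sup>2"
proof -
  have D0: "0 \<le> D" using G[OF \<open>0 < n\<close>] norm_ge_zero order.trans by blast
  have step: "f i z - f i u - 2 * D * r \<le> inner (G i) (z - u)" if i: "i < n" for i
  proof -
    have 1: "f i (xs i) + inner (G i) (u - xs i) \<le> f i u"
      using sub[OF i] by (simp add: is_subgradient_def)
    have 2: "f i z + inner (Gz i) (xs i - z) \<le> f i (xs i)"
      using subz[OF i] by (simp add: is_subgradient_def)
    have dv: "\<bar>inner h (xs i - z)\<bar> \<le> D * r" if "norm h \<le> D" for h
      using Cauchy_Schwarz_ineq2[of h "xs i - z"] mult_mono[OF that dev[OF i] D0] by simp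
    have 3: "\<bar>inner (G i) (xs i - z)\<bar> \<le> D * r" "\<bar>inner (Gz i) (xs i - z)\<bar> \<le> D * r"
      using dv G[OF i] Gz[OF i] by auto
    have "inner (G i) (z - u) = - inner (G i) (u - xs i) - inner (G i) (xs i - z)"
      by (simp add: inner_diff_right)
    then show ?thesis using 1 2 3 by linarith
  qed
  have "(\<Sum>i<n. f i z - f i u - 2 * D * r) \<le> (\<Sum>i<n. inner (G i) (z - u))"
    using step by (intro sum_mono) auto
  then have lower: "(\<Sum>i<n. f i z) - (\<Sum>i<n. f i u) - n * (2 * D * r) \<le> inner (\<Sum>i<n. G i) (z - u)"
    by (simp add: sum_subtractf inner_sum_left)
  define S where "S = (\<Sum>i<n. G i)"
  define b where "b = a / real n"
  have b0: "0 \<le> b" using al by (simp add: b_def)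
  have bn: "b * n = a" using \<open>0 < n\<close> by (simp add: b_def)
  have "norm S \<le> (\<Sum>i<n. D)"
    unfolding S_def using G by (intro order.trans[OF norm_sum] sum_mono) auto
  then have "b * norm S \<le> b * (n * D)" using b0 by (intro mult_left_mono) auto
  also have "\<dots> = a * D" using bn by (simp flip: mult.assoc)
  finally have "(b * norm S)\<^sup>2 \<le> (a * D)\<^sup>2" using b0 by (intro power_mono) auto
  then have sq: "b\<^sup>2 * (norm S)\<^sup>2 \<le> D\<^sup>2 * a\<^sup>2" by (simp add: power_mult_distrib mult.commute)
  have "inner (w - b *\<^sub>R S) (w - b *\<^sub>R S) = inner w w - 2 * b * inner S w + b\<^sup>2 * inner S S" for w
    by (simp add: inner_diff_left inner_diff_right inner_commute[of w S] power2_eq_square algebra_simps)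
  moreover have "z' - u = (z - u) - b *\<^sub>R S" by (simp add: z' b_def S_def)
  ultimately have "(norm (z' - u))\<^sup>2 = (norm (z - u))\<^sup>2 - 2 * b * inner S (z - u) + b\<^sup>2 * (norm S)\<^sup>2"
    by (simp only: power2_norm_eq_inner)
  moreover have "2 * b * ((\<Sum>i<n. f i z) - (\<Sum>i<n. f i u) - n * (2 * D * r)) \<le> 2 * b * inner S (z - u)"
    using lower b0 unfolding S_def by (intro mult_left_mono) auto
  then have "2 * b * ((\<Sum>i<n. f i z) - (\<Sum>i<n. f i u)) - 4 * D * ((b * n) * r) \<le> 2 * b * inner S (z - u)"
    by (simp add: algebra_simps)
  ultimately show ?thesis using sq unfolding bn by (simp add: b_def)
qed

theorem mainTheorem2:
  fixes n :: nat and E :: "(nat \<times> nat) set" and A B :: "real mat"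
    and f :: "nat \<Rightarrow> 'a::euclidean_space \<Rightarrow> real" and F :: "'a \<Rightarrow> real"
    and g :: "nat \<Rightarrow> nat \<Rightarrow> 'a \<Rightarrow> 'a"
    and x y :: "nat \<Rightarrow> nat \<Rightarrow> 'a"
    and \<alpha> :: "nat \<Rightarrow> real" and \<epsilon> D fstar :: real
  assumes "network n E" and "strongly_connected n E"
    and "row_weights n E A" and "col_weights n E B"
    and "\<And>i. i < n \<Longrightarrow> convex_on UNIV (f i)"
    and "\<And>k i u. i < n \<Longrightarrow> is_subgradient (f i) u (g k i u)"
    and "\<And>k i u. i < n \<Longrightarrow> norm (g k i u) \<le> D"
    and "F = (\<lambda>u. \<Sum>i<n. f i u)"
    and "\<exists>u. F u = fstar" and "\<And>u. fstar \<le> F u"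
    and "\<epsilon> \<in> {0<..<Upsilon n A B}"
    and "0 \<le> \<alpha> 0" and "\<And>k. 1 \<le> k \<Longrightarrow> \<alpha> k = real k powr (-1/2)"
    and "D_DGD n A B \<epsilon> \<alpha> g x y"
  shows "(\<lambda>K. Min ((\<lambda>k. F (zbar n x y k)) ` {0..K}) - fstar)
           \<in> O[at_top](\<lambda>K. ln (real K) / sqrt (real K))"
proof -
  note sub = assms(6) and gD = assms(7) and F = assms(8) and fmin = assms(10)
    and \<alpha> = assms(13) and dgd = assms(14)
  have n: "0 < n" using assms(1) by (simp add: network_def)
  have col: "\<And>j. j < n \<Longrightarrow> (\<Sum>i<n. B $$ (i, j)) = 1" using assms(4) by (simp add: col_weights_def)
  have D0: "0 \<le> D" using gD[OF n] norm_ge_zero order.trans by blast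
  have al: "0 \<le> \<alpha> k" for k using assms(12) \<alpha>[of k] by (cases "k = 0") auto
  obtain u where u: "F u = fstar" using assms(9) by blast
  obtain C \<gamma> where C: "0 \<le> C" and \<gamma>: "0 < \<gamma>" "\<gamma> < 1"
    and dev: "\<And>k i. i < n \<Longrightarrow> norm (x k i - zbar n x y k) \<le> C * discounted_sum \<gamma> \<alpha> k"
    using D_DGD_consensus[OF assms(1-4) assms(11) dgd al gD] by blast
  let ?s = "discounted_sum \<gamma> \<alpha>"
  define V where "V k = (norm (zbar n x y k - u))\<^sup>2" for k
  define m where "m K = Min ((\<lambda>k. F (zbar n x y k)) ` {0..K}) - fstar" for K
  \<comment> \<open>\<open>g k i\<close> yields a sub-gradient at every point, so it also supplies
    the auxiliary one at \<open>zbar\<close>.\<close>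
  have step: "2 * \<alpha> k / n * (F (zbar n x y k) - fstar)
      \<le> V k - V (Suc k) + 4 * D * C * (\<alpha> k * ?s k) + D\<^sup>2 * (\<alpha> k)\<^sup>2" for k
    using subgradient_descent_step[where xs = "x k" and G = "\<lambda>i. g k i (x k i)" and z = "zbar n x y k"
        and Gz = "\<lambda>i. g k i (zbar n x y k)" and D = D and f = f and u = u,
        OF n al[of k] sub sub gD gD dev D_DGD_zbar_step[OF dgd col]]
    unfolding V_def u[symmetric] F by (simp add: mult.assoc mult.left_commute)
  define c1 where "c1 = \<alpha> 1 * ?s 1"
  have c1: "0 \<le> c1" unfolding c1_def
    using al \<gamma> discounted_sum_nonneg[of \<gamma> \<alpha> 1] by (intro mult_nonneg_nonneg) auto
  define Q where "Q = V 1 + 4 * D * C * ((c1 + 2) / (1 - \<gamma>)) + 2 * D\<^sup>2"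
  have m0: "0 \<le> m K" for K
    unfolding m_def using fmin by simp
  \<comment> \<open>From \<open>K = 3\<close> on \<open>ln K\<close> is at least 1, so bounded terms
    may be multiplied by it and collected in \<open>Q\<close>.\<close>
  have bound: "m K \<le> (n * Q / 2) * (ln K / sqrt K)" if K: "3 \<le> K" for K :: nat
  proof -
    have "1 = ln (exp 1 :: real)" by simp
    also have "\<dots> \<le> ln 3" using exp_le by (subst ln_le_cancel_iff) auto
    also have "\<dots> \<le> ln K" using K by simp
    finally have lnK: "1 \<le> ln K" .
    have sq: "(\<alpha> k)\<^sup>2 = 1 / real k" if "1 \<le> k" for k
      using that \<alpha>[OF that] by (simp add: power2_eq_square powr_minus_divide flip: powr_add)
    have "(\<Sum>k=1..K. (\<alpha> k)\<^sup>2) = (\<Sum>k=1..K. 1 / real k)" using sq by (intro sum.cong) auto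
    then have S: "(\<Sum>k=1..K. (\<alpha> k)\<^sup>2) \<le> 2 * ln K" using sum_inverse_le_one_plus_ln[of K] K lnK by simp
    have dec: "\<alpha> (Suc k) \<le> \<alpha> k" if "1 \<le> k" for k
      using that \<alpha>[of k] \<alpha>[of "Suc k"] by (auto intro!: powr_mono2')
    have "(\<Sum>k=1..K. \<alpha> k * ?s k) \<le> (c1 + (\<Sum>k=1..K. (\<alpha> k)\<^sup>2)) / (1 - \<gamma>)"
      unfolding c1_def using \<gamma> al dec K by (intro sum_discounted_sum_le) auto
    also have "\<dots> \<le> (c1 * ln K + 2 * ln K) / (1 - \<gamma>)"
      using S \<gamma> mult_left_mono[OF lnK c1] by (intro divide_right_mono add_mono) auto
    also have "\<dots> = (c1 + 2) / (1 - \<gamma>) * ln K" by (simp add: algebra_simps)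
    finally have T: "(\<Sum>k=1..K. \<alpha> k * ?s k) \<le> (c1 + 2) / (1 - \<gamma>) * ln K" .
    \<comment> \<open>The weighted sum leaves out \<open>k = 0\<close>, where the step size is
      arbitrary; the minimum over \<open>{0..K}\<close> is still below every term that is
      kept.\<close>
    have "2 / n * m K * sqrt K \<le> 2 / n * m K * (\<Sum>k=1..K. real k powr (-1/2))"
      using sum_powr_half_ge[of K] K m0[of K] by (intro mult_left_mono) auto
    also have "\<dots> = (\<Sum>k=1..K. 2 * \<alpha> k / n * m K)"
      unfolding sum_distrib_left using \<alpha> by (intro sum.cong refl) simp
    also have "\<dots> \<le> (\<Sum>k=1..K. 2 * \<alpha> k / n * (F (zbar n x y k) - fstar))"
      using al by (intro sum_mono mult_left_mono) (auto simp: m_def)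
    also have "\<dots> \<le> (\<Sum>k=1..K. V k - V (Suc k) + 4 * D * C * (\<alpha> k * ?s k) + D\<^sup>2 * (\<alpha> k)\<^sup>2)"
      by (intro sum_mono step)
    also have "\<dots> = (\<Sum>k=1..K. V k - V (Suc k)) + 4 * D * C * (\<Sum>k=1..K. \<alpha> k * ?s k) + D\<^sup>2 * (\<Sum>k=1..K. (\<alpha> k)\<^sup>2)"
      by (simp add: sum.distrib sum_distrib_left)
    also have "(\<Sum>k=1..K. V k - V (Suc k)) = V 1 - V (Suc K)"
      using K by (induction K rule: dec_induct) (auto simp: numeral_3_eq_3)
    also have "V 1 - V (Suc K) \<le> V 1 * ln K"
    proof -
      have "0 \<le> V 1" "0 \<le> V (Suc K)" by (simp_all add: V_def)
      then show ?thesis using mult_left_mono[OF lnK, of "V 1"] by linarith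
    qed
    also have "4 * D * C * (\<Sum>k=1..K. \<alpha> k * ?s k) \<le> 4 * D * C * ((c1 + 2) / (1 - \<gamma>) * ln K)"
      using D0 C by (intro mult_left_mono T) auto
    also have "D\<^sup>2 * (\<Sum>k=1..K. (\<alpha> k)\<^sup>2) \<le> D\<^sup>2 * (2 * ln K)" by (intro mult_left_mono S) auto
    also have "V 1 * ln K + 4 * D * C * ((c1 + 2) / (1 - \<gamma>) * ln K) + D\<^sup>2 * (2 * ln K) = Q * ln K"
      unfolding Q_def by (simp only: distrib_right mult.assoc mult.left_commute)
    finally have "2 / n * m K * sqrt K \<le> Q * ln K" by simp
    then show ?thesis using n K by (simp add: field_simps)
  qed
  show ?thesis
    unfolding m_def[symmetric]
  proof (rule bigoI[of _ "n * Q / 2"])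
    show "\<forall>\<^sub>F K in at_top. norm (m K) \<le> n * Q / 2 * norm (ln (real K) / sqrt (real K))"
      using eventually_ge_at_top[of 3]
    proof eventually_elim
      case (elim K)
      have "0 \<le> ln (real K) / sqrt (real K)" using elim by simp
      then show ?case using bound[OF elim] m0[of K] by (simp only: real_norm_def abs_of_nonneg)
    qed
  qed
qed

end
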